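(* Let $0<T<+\infty$, let $X,Y$ be real Hilbert spaces, $C\in\mathcal L(X,Y)$, and let $(A(t))_{t\in[0,T]}$ be a family of operators on $X$ with common dense domain $D$ satisfying the standing assumptions of the context, generating the bi-directional evolution system $(\mathbb T(t,s))_{0\le s,t\le T}$. Let $\mathcal O_T$ be the observable subspace at time $T$ of the pair $(\mathbb T,C)$. (i) Let $\mu\ge0$, suppose that both $((A(t))_{t\in[0,T]},C)$ and $((-A(t))_{t\in[0,T]},C)$ are $\mu$-weakly detectable, and let $r>\mu$. Assume that $\mathbb S_-(0,T)=\mathbb S_+(T,0)^*$. If $\mathcal O_T=X$, then the back and forth nudging system is a strong back and forth observer of the system, i.e. for all $\varepsilon_0\in X$, $$\varepsilon^{2n}(0)=\big(\mathbb S_-(0,T)\,\mathbb S_+(T,0)\big)^n\varepsilon_0\to0\quad\text{in norm in } X \text{ as } n\to+\infty.$$ (ii) In the autonomous context (there is an operator $A:D\to X$ with $A(t)=A$ for all $t$), if $A$ is skew-adjoint, then for all $r>0$ the back and forth nudging system is a strong back and forth $\mathcal O_T$-observer of the system, i.e. for all $\varepsilon_0\in X$, $$\Pi_{\mathcal O_T}\,\varepsilon^{2n}(0)=\Pi_{\mathcal O_T}\big(\mathbb S_-(0,T)\,\mathbb S_+(T,0)\big)^n\varepsilon_0\to0\quad\text{in norm in } X \text{ as } n\to+\infty.$$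
   Context: $\mathcal L(X,Y)$ denotes bounded linear operators, $\mathcal L(X)=\mathcal L(X,X)$; $C^*$ is the adjoint of $C$. For a closed linear subspace $E\subset X$, $\Pi_E\in\mathcal L(X)$ is the orthogonal projection onto $E$. $A$ is skew-adjoint if $A^*=-A$ (with equality of domains). Standing assumptions: $D\subset X$ is a dense subspace; each of the families $(B(t))_{t\in[0,T]}=(A(t))_{t\in[0,T]}$ and $(B(t))_{t\in[0,T]}=(-A(T-t))_{t\in[0,T]}$ consists of generators $B(t):D\to X$ of strongly continuous semigroups and is stable (in Pazy's sense): there are $M\ge1$, $\omega\in\mathbb R$ with $(\omega,\infty)\subset\rho(B(t))$ and $\|\prod_{j=1}^k(\lambda-B(t_j))^{-1}\|\le M(\lambda-\omega)^{-k}$ for all $\lambda>\omega$ and finite sequences $0\le t_1\le\dots\le t_k\le T$ (time-ordered product); for every $x\in D$, $t\mapsto A(t)x$ is continuously differentiable in $X$. An evolution system $(U(t,s))_{0\le s\le t\le T}$ is a family in $\mathcal L(X)$ with $U(s,s)=\mathrm{Id}$, $U(t,\sigma)U(\sigma,s)=U(t,s)$ for $s\le\sigma\le t$, and $(t,s)\mapsto U(t,s)x$ continuous for all $x$. It is generated by $(B(t))$ if for $x\in D$, $U(t,s)x\in D$, $\partial_tU(t,s)x=B(t)U(t,s)x$ and $\partial_sU(t,s)x=-U(t,s)B(s)x$. A bi-directional evolution system on $X$ over $[0,T]$ is a family $(U(t,s))_{0\le s,t\le T}$ in $\mathcal L(X)$ with $U(t,t)=\mathrm{Id}$, $U(t,s)U(s,\sigma)=U(t,\sigma)$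 for all $t,s,\sigma\in[0,T]$, and $U(t,s)x\to x$ as $s\to t$ for all $x\in X$. $(A(t))$ generates the bi-directional evolution system $U$ if $(A(t))$ generates the evolution system $(U(t,s))_{0\le s\le t\le T}$, $(-A(T-t))$ generates the evolution system $(U(T-t,T-s))_{0\le s\le t\le T}$, and $U(s,t)U(t,s)=\mathrm{Id}$ for all $s,t$. Then there are $M,\omega>0$ with $\|\mathbb T(t,s)\|\le Me^{\omega|t-s|}$, and, for $r>0$, $(A(t)-rC^*C)_{t\in[0,T]}$ and $(A(t)+rC^*C)_{t\in[0,T]}$ generate bi-directional evolution systems denoted $\mathbb S_+$ and $\mathbb S_-$ respectively. System: $\dot z=A(t)z$, $z(0)=z_0$, $y=Cz$ on $[0,T]$. Back and forth nudging system with gain $r>0$ and $\hat z_0\in X$: for $n\in\mathbb N$, $\dot{\hat z}^{2n}=A(t)\hat z^{2n}-rC^*(C\hat z^{2n}-y)$ with $\hat z^{2n}(0)=\hat z^{2n-1}(0)$ if $n\ge1$, $\hat z^0(0)=\hat z_0$; and $\dot{\hat z}^{2n+1}=A(t)\hat z^{2n+1}+rC^*(C\hat z^{2n+1}-y)$ with $\hat z^{2n+1}(T)=\hat z^{2n}(T)$. The error is $\varepsilon^n=\hat z^n-z$, $\varepsilon_0=\hat z_0-z_0$, and $\varepsilon^{2n}(0)=(\mathbb S_-(0,T)\mathbb S_+(T,0))^n\varepsilon_0$. For a closed linear subspace $\mathcal O\subset X$, the back and forth nudging system is a strong back and forth $\mathcal O$-observer of the system if $\Pi_{\mathcal O}\varepsilon^{2n}(0)\to0$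 in norm as $n\to+\infty$ for all $\varepsilon_0\in X$; an $X$-observer is simply called an observer. $((\pm A(t))_{t\in[0,T]},C)$ is $\mu$-weakly detectable if $\pm\langle A(t)x,x\rangle_X\le\mu\|Cx\|_Y^2$ for all $t\in[0,T]$, $x\in D$. $W(0,T)z_0=\int_0^T\mathbb T(t,0)^*C^*C\,\mathbb T(t,0)z_0\,dt$, and the observable subspace at time $T$ of $(\mathbb T,C)$ is $\mathcal O_T=(\ker W(0,T))^\perp$. *)

theory Defs
  imports "HOL-Analysis.Analysis"
begin

text \<open>
  Real Hilbert spaces are types of sort \<open>{real_inner, banach}\<close>. An unbounded operator with domain
  \<open>D\<close> is a function \<open>'a \<Rightarrow> 'a\<close> of which only the values on \<open>D\<close> matter; a family of operators or
  an evolution system is a function on \<open>real\<close> (resp. \<open>real \<times> real\<close>, curried) of which only the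
  values for times in \<open>{0..T}\<close> matter. The adjoint of a bounded operator is the library's
  \<open>adjoint\<close>, and \<open>onorm\<close> is the operator norm.
\<close>

section \<open>Hilbert space preliminaries\<close>

definition orth_proj :: "'a::real_inner set \<Rightarrow> 'a \<Rightarrow> 'a" where
  "orth_proj E x = (THE p. p \<in> E \<and> x - p \<in> orthogonal_comp E)"

definition unbounded_adjoint_dom :: "'a::real_inner set \<Rightarrow> ('a \<Rightarrow> 'a) \<Rightarrow> 'a set" where
  "unbounded_adjoint_dom D A = {y. \<exists>w. \<forall>x\<in>D. A x \<bullet> y = x \<bullet> w}"

text \<open>The vector is unique because \<open>D\<close> is dense wherever this is used.\<close>

definition unbounded_adjoint :: "'a::real_inner set \<Rightarrow> ('a \<Rightarrow> 'a) \<Rightarrow> 'a \<Rightarrow> 'a" where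
  "unbounded_adjoint D A y = (THE w. \<forall>x\<in>D. A x \<bullet> y = x \<bullet> w)"

definition skew_adjoint :: "'a::real_inner set \<Rightarrow> ('a \<Rightarrow> 'a) \<Rightarrow> bool" where
  "skew_adjoint D A \<longleftrightarrow>
     unbounded_adjoint_dom D A = D \<and> (\<forall>y\<in>D. unbounded_adjoint D A y = - A y)"

section \<open>Semigroups, resolvents and stable families\<close>

definition C0_semigroup :: "(real \<Rightarrow> 'a::real_normed_vector \<Rightarrow> 'a) \<Rightarrow> bool" where
  "C0_semigroup S \<longleftrightarrow>
     (\<forall>t\<ge>0. bounded_linear (S t)) \<and> S 0 = id \<and>
     (\<forall>s\<ge>0. \<forall>t\<ge>0. S (s + t) = S s \<circ> S t) \<and>
     (\<forall>x. ((\<lambda>t. S t x) \<longlongrightarrow> x) (at_right 0))"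

definition generator_of :: "(real \<Rightarrow> 'a::real_normed_vector \<Rightarrow> 'a) \<Rightarrow> 'a set \<Rightarrow> ('a \<Rightarrow> 'a) \<Rightarrow> bool" where
  "generator_of S D B \<longleftrightarrow>
     D = {x. \<exists>y. ((\<lambda>h. (S h x - x) /\<^sub>R h) \<longlongrightarrow> y) (at_right 0)} \<and>
     (\<forall>x\<in>D. ((\<lambda>h. (S h x - x) /\<^sub>R h) \<longlongrightarrow> B x) (at_right 0))"

definition generates_C0_semigroup :: "'a::real_normed_vector set \<Rightarrow> ('a \<Rightarrow> 'a) \<Rightarrow> bool" where
  "generates_C0_semigroup D B \<longleftrightarrow> (\<exists>S. C0_semigroup S \<and> generator_of S D B)"

definition resolvent :: "'a::real_normed_vector set \<Rightarrow> ('a \<Rightarrow> 'a) \<Rightarrow> real \<Rightarrow> 'a \<Rightarrow> 'a" where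
  "resolvent D B l = the_inv_into D (\<lambda>x. l *\<^sub>R x - B x)"

definition resolvent_set :: "'a::real_normed_vector set \<Rightarrow> ('a \<Rightarrow> 'a) \<Rightarrow> real set" where
  "resolvent_set D B =
     {l. bij_betw (\<lambda>x. l *\<^sub>R x - B x) D UNIV \<and> bounded_linear (resolvent D B l)}"

text \<open>
  Stability in the sense of Pazy. The product is time-ordered, with later times further to the
  left: for \<open>ts = [t1, ..., tk]\<close> the \<open>fold\<close> below is \<open>R tk (... (R t1 x))\<close>
  with \<open>R t = (l - B(t))\<^sup>-\<^sup>1\<close>.
\<close>

definition stable_family :: "real \<Rightarrow> 'a::real_normed_vector set \<Rightarrow> (real \<Rightarrow> 'a \<Rightarrow> 'a) \<Rightarrow> bool" where
  "stable_family T D B \<longleftrightarrow>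
     (\<exists>M \<omega>. M \<ge> 1 \<and>
        (\<forall>t\<in>{0..T}. {\<omega><..} \<subseteq> resolvent_set D (B t)) \<and>
        (\<forall>l>\<omega>. \<forall>ts. sorted ts \<and> set ts \<subseteq> {0..T} \<longrightarrow>
           onorm (\<lambda>x. fold (\<lambda>t. resolvent D (B t) l) ts x) \<le> M / (l - \<omega>) ^ length ts))"

definition standing_assumptions ::
    "real \<Rightarrow> 'a::real_normed_vector set \<Rightarrow> (real \<Rightarrow> 'a \<Rightarrow> 'a) \<Rightarrow> bool" where
  "standing_assumptions T D A \<longleftrightarrow>
     subspace D \<and> closure D = UNIV \<and>
     (\<forall>t\<in>{0..T}. generates_C0_semigroup D (A t)) \<and>
     (\<forall>t\<in>{0..T}. generates_C0_semigroup D (\<lambda>x. - A (T - t) x)) \<and>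
     stable_family T D A \<and>
     stable_family T D (\<lambda>t x. - A (T - t) x) \<and>
     (\<forall>x\<in>D. \<exists>A'. continuous_on {0..T} A' \<and>
        (\<forall>t\<in>{0..T}. ((\<lambda>s. A s x) has_vector_derivative A' t) (at t within {0..T})))"

section \<open>Evolution systems\<close>

definition evolution_system :: "real \<Rightarrow> (real \<Rightarrow> real \<Rightarrow> 'a::real_normed_vector \<Rightarrow> 'a) \<Rightarrow> bool" where
  "evolution_system T U \<longleftrightarrow>
     (\<forall>s t. 0 \<le> s \<and> s \<le> t \<and> t \<le> T \<longrightarrow> bounded_linear (U t s)) \<and>
     (\<forall>s\<in>{0..T}. U s s = id) \<and>
     (\<forall>s \<sigma> t. 0 \<le> s \<and> s \<le> \<sigma> \<and> \<sigma> \<le> t \<and> t \<le> T \<longrightarrow> U t \<sigma> \<circ> U \<sigma> s = U t s) \<and>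
     (\<forall>x. continuous_on {(t, s). 0 \<le> s \<and> s \<le> t \<and> t \<le> T} (\<lambda>(t, s). U t s x))"

text \<open>The derivatives are one-sided at the boundary of the triangle \<open>0 \<le> s \<le> t \<le> T\<close>.\<close>

definition generates_evolution_system ::
    "real \<Rightarrow> 'a::real_normed_vector set \<Rightarrow> (real \<Rightarrow> 'a \<Rightarrow> 'a) \<Rightarrow> (real \<Rightarrow> real \<Rightarrow> 'a \<Rightarrow> 'a) \<Rightarrow> bool" where
  "generates_evolution_system T D B U \<longleftrightarrow>
     evolution_system T U \<and>
     (\<forall>s t. 0 \<le> s \<and> s \<le> t \<and> t \<le> T \<longrightarrow> (\<forall>x\<in>D.
        U t s x \<in> D \<and>
        ((\<lambda>\<tau>. U \<tau> s x) has_vector_derivative B t (U t s x)) (at t within {s..T}) \<and>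
        ((\<lambda>\<sigma>. U t \<sigma> x) has_vector_derivative - U t s (B s x)) (at s within {0..t})))"

definition bidirectional_evolution_system ::
    "real \<Rightarrow> (real \<Rightarrow> real \<Rightarrow> 'a::real_normed_vector \<Rightarrow> 'a) \<Rightarrow> bool" where
  "bidirectional_evolution_system T U \<longleftrightarrow>
     (\<forall>t\<in>{0..T}. \<forall>s\<in>{0..T}. bounded_linear (U t s)) \<and>
     (\<forall>t\<in>{0..T}. U t t = id) \<and>
     (\<forall>t\<in>{0..T}. \<forall>s\<in>{0..T}. \<forall>\<sigma>\<in>{0..T}. U t s \<circ> U s \<sigma> = U t \<sigma>) \<and>
     (\<forall>t\<in>{0..T}. \<forall>x. ((\<lambda>s. U t s x) \<longlongrightarrow> x) (at t within {0..T}))"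

definition generates_bidirectional ::
    "real \<Rightarrow> 'a::real_normed_vector set \<Rightarrow> (real \<Rightarrow> 'a \<Rightarrow> 'a) \<Rightarrow> (real \<Rightarrow> real \<Rightarrow> 'a \<Rightarrow> 'a) \<Rightarrow> bool" where
  "generates_bidirectional T D B U \<longleftrightarrow>
     bidirectional_evolution_system T U \<and>
     generates_evolution_system T D B U \<and>
     generates_evolution_system T D (\<lambda>t x. - B (T - t) x) (\<lambda>t s. U (T - t) (T - s)) \<and>
     (\<forall>t\<in>{0..T}. \<forall>s\<in>{0..T}. U s t \<circ> U t s = id)"

section \<open>Solutions, nudging and observers\<close>

text \<open>
  \<open>z\<close> is the (mild) solution on \<open>[0,T]\<close> of \<open>z' = B(t) z + f(t)\<close>, \<open>z(t\<^sub>0) = v\<close>, that is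
  \<open>z(t) = U(t,t\<^sub>0) v + \<integral> U(t,s) f(s) ds\<close> with the oriented integral from \<open>t\<^sub>0\<close> to \<open>t\<close>.
\<close>

definition mild_solution ::
    "real \<Rightarrow> 'a::real_normed_vector set \<Rightarrow> (real \<Rightarrow> 'a \<Rightarrow> 'a) \<Rightarrow> (real \<Rightarrow> 'a) \<Rightarrow> real \<Rightarrow> 'a
      \<Rightarrow> (real \<Rightarrow> 'a) \<Rightarrow> bool" where
  "mild_solution T D B f t0 v z \<longleftrightarrow>
     (\<exists>U. generates_bidirectional T D B U \<and>
        (\<forall>t\<in>{0..T}.
           (\<lambda>s. U t s (f s)) integrable_on {min t0 t..max t0 t} \<and>
           z t = U t t0 v +
             (if t0 \<le> t then integral {t0..t} (\<lambda>s. U t s (f s))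
              else - integral {t..t0} (\<lambda>s. U t s (f s)))))"

definition system_solution ::
    "real \<Rightarrow> 'a::real_normed_vector set \<Rightarrow> (real \<Rightarrow> 'a \<Rightarrow> 'a) \<Rightarrow> 'a \<Rightarrow> (real \<Rightarrow> 'a) \<Rightarrow> bool" where
  "system_solution T D A z0 z \<longleftrightarrow> mild_solution T D A (\<lambda>_. 0) 0 z0 z"

text \<open>
  The right-hand side \<open>A(t) w - r C\<^sup>*(C w - y)\<close> is written \<open>(A(t) - r C\<^sup>* C) w + r C\<^sup>* y\<close>, so that
  its mild solutions are those of the evolution system generated by \<open>A(t) - r C\<^sup>* C\<close>. The backward
  equation is the same with \<open>-r\<close> in place of \<open>r\<close>.
\<close>

definition nudged :: "(real \<Rightarrow> 'a::real_inner \<Rightarrow> 'a) \<Rightarrow> ('a \<Rightarrow> 'b::real_inner) \<Rightarrow> real \<Rightarrow> real \<Rightarrow> 'a \<Rightarrow> 'a" where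
  "nudged A C r t x = A t x - r *\<^sub>R adjoint C (C x)"

definition nudging_solution ::
    "real \<Rightarrow> 'a::real_inner set \<Rightarrow> (real \<Rightarrow> 'a \<Rightarrow> 'a) \<Rightarrow> ('a \<Rightarrow> 'b::real_inner) \<Rightarrow> real
      \<Rightarrow> (real \<Rightarrow> 'b) \<Rightarrow> real \<Rightarrow> 'a \<Rightarrow> (real \<Rightarrow> 'a) \<Rightarrow> bool" where
  "nudging_solution T D A C r y t0 v z \<longleftrightarrow>
     mild_solution T D (nudged A C r) (\<lambda>t. r *\<^sub>R adjoint C (y t)) t0 v z"

definition back_and_forth_nudging ::
    "real \<Rightarrow> 'a::real_inner set \<Rightarrow> (real \<Rightarrow> 'a \<Rightarrow> 'a) \<Rightarrow> ('a \<Rightarrow> 'b::real_inner) \<Rightarrow> real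
      \<Rightarrow> (real \<Rightarrow> 'b) \<Rightarrow> 'a \<Rightarrow> (nat \<Rightarrow> real \<Rightarrow> 'a) \<Rightarrow> bool" where
  "back_and_forth_nudging T D A C r y zhat0 zhat \<longleftrightarrow>
     nudging_solution T D A C r y 0 zhat0 (zhat 0) \<and>
     (\<forall>n\<ge>1. nudging_solution T D A C r y 0 (zhat (2 * n - 1) 0) (zhat (2 * n))) \<and>
     (\<forall>n. nudging_solution T D A C (- r) y T (zhat (2 * n) T) (zhat (2 * n + 1)))"

text \<open>
  Quantifying over all initial states \<open>z0\<close> of the system and \<open>zhat0\<close> of the observer amounts to
  quantifying over all initial errors \<open>zhat0 - z0\<close>.
\<close>

definition strong_back_and_forth_observer ::
    "real \<Rightarrow> 'a::real_inner set \<Rightarrow> (real \<Rightarrow> 'a \<Rightarrow> 'a) \<Rightarrow> ('a \<Rightarrow> 'b::real_inner) \<Rightarrow> real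
      \<Rightarrow> 'a set \<Rightarrow> bool" where
  "strong_back_and_forth_observer T D A C r E \<longleftrightarrow>
     (\<forall>z0 zhat0 z zhat.
        system_solution T D A z0 z \<and>
        back_and_forth_nudging T D A C r (\<lambda>t. C (z t)) zhat0 zhat \<longrightarrow>
        (\<lambda>n. orth_proj E (zhat (2 * n) 0 - z 0)) \<longlonglongrightarrow> 0)"

definition weakly_detectable ::
    "real \<Rightarrow> real \<Rightarrow> 'a::real_inner set \<Rightarrow> (real \<Rightarrow> 'a \<Rightarrow> 'a) \<Rightarrow> ('a \<Rightarrow> 'b::real_inner) \<Rightarrow> bool" where
  "weakly_detectable \<mu> T D A C \<longleftrightarrow>
     (\<forall>t\<in>{0..T}. \<forall>x\<in>D. A t x \<bullet> x \<le> \<mu> * (norm (C x))\<^sup>2)"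

definition observability_gramian ::
    "real \<Rightarrow> (real \<Rightarrow> real \<Rightarrow> 'a::real_inner \<Rightarrow> 'a) \<Rightarrow> ('a \<Rightarrow> 'b::real_inner) \<Rightarrow> 'a \<Rightarrow> 'a" where
  "observability_gramian T U C z0 =
     integral {0..T} (\<lambda>t. adjoint (U t 0) (adjoint C (C (U t 0 z0))))"

definition observable_subspace ::
    "real \<Rightarrow> (real \<Rightarrow> real \<Rightarrow> 'a::real_inner \<Rightarrow> 'a) \<Rightarrow> ('a \<Rightarrow> 'b::real_inner) \<Rightarrow> 'a set" where
  "observable_subspace T U C = orthogonal_comp {z0. observability_gramian T U C z0 = 0}"

end

theory Submission
  imports Defs
begin

text \<open>
  Write \<open>S\<close> for \<open>Sp T 0\<close>, the forward pass of the observer, and \<open>L\<close> for one round trip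
  \<open>Sm 0 T \<circ> Sp T 0\<close>. In both parts the argument shows that \<open>L = S\<^sup>* S\<close>, that \<open>L\<^sup>n x\<close> converges for
  every \<open>x\<close>, and that the limit lies in the kernel of the observability Gramian.

  Weak detectability makes \<open>S\<close> a contraction with a quantified loss:
  \<open>\<parallel>S x\<parallel>\<^sup>2 + 2 (r - \<mu>) \<integral> \<parallel>C (Sp t 0 x)\<parallel>\<^sup>2 dt \<le> \<parallel>x\<parallel>\<^sup>2\<close> (\<open>nudged_energy_dissipation\<close>). The powers of
  the positive symmetric contraction \<open>S\<^sup>* S\<close> converge strongly to fixed points
  (\<open>powers_of_adjoint_comp_contraction_converge\<close>). A fixed point \<open>y\<close> satisfies
  \<open>\<parallel>S y\<parallel>\<^sup>2 = L y \<bullet> y = \<parallel>y\<parallel>\<^sup>2\<close>, so the nudged trajectory from \<open>y\<close> has zero output. It then receives no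
  correction and coincides with the free trajectory, whose output vanishes too
  (\<open>norm_conserved_imp_unobservable\<close>). If the observable subspace is everything, this leaves only
  \<open>y = 0\<close>. In general \<open>y\<close> is orthogonal to the observable subspace, hence the projections of
  \<open>L\<^sup>n x\<close> onto it tend to zero.

  The identity \<open>Sm 0 T = S\<^sup>*\<close> is a hypothesis of the first part. In the second part it follows from
  skew-adjointness, as does weak detectability with \<open>\<mu> = 0\<close>, because then \<open>Sp t 0 x \<bullet> Sm t T y\<close> is
  constant in \<open>t\<close> (\<open>backward_nudged_eq_adjoint_of_forward\<close>).

  The comparison of trajectories rests on Duhamel's formula for a bounded perturbation of the
  generator (\<open>duhamel\<close>). It also yields uniqueness of the evolution system generated by a family, and
  it identifies the error of the nudging iteration with \<open>L\<^sup>n\<close> applied to the initial error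
  (\<open>back_and_forth_error\<close>).
\<close>

section \<open>Hilbert space preliminaries\<close>

lemma Cauchy_if_square_dist_le:
  fixes s :: "nat \<Rightarrow> 'a::real_normed_vector"
  assumes le: "\<And>i j. (norm (s i - s j))\<^sup>2 \<le> c i + c j" and c: "c \<longlonglongrightarrow> (0::real)"
  shows "Cauchy s"
proof (rule CauchyI)
  fix e :: real assume e: "0 < e"
  have "\<forall>\<^sub>F n in sequentially. c n < e\<^sup>2 / 2"
    using order_tendstoD(2)[OF c, of "e\<^sup>2 / 2"] e by simp
  then obtain N where N: "\<And>n. n \<ge> N \<Longrightarrow> c n < e\<^sup>2 / 2"
    by (auto simp: eventually_sequentially)
  have "norm (s i - s j) < e" if "i \<ge> N" "j \<ge> N" for i j
  proof (rule power2_less_imp_less)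
    show "(norm (s i - s j))\<^sup>2 < e\<^sup>2" using le[of i j] N[OF that(1)] N[OF that(2)] by linarith
  qed (use e in simp)
  then show "\<exists>M. \<forall>m\<ge>M. \<forall>n\<ge>M. norm (s m - s n) < e" by blast
qed

text \<open>
  The representing vector is the minimiser over \<open>E\<close> of \<open>J x = \<parallel>x\<parallel>\<^sup>2 / 2 - \<phi> x\<close>: by the parallelogram
  identity a minimising sequence is Cauchy, and the first variation of \<open>J\<close> at the minimiser
  vanishes. With \<open>E = UNIV\<close> this gives adjoints, and with \<open>\<phi> = (\<bullet>) y\<close> it gives orthogonal
  projections.
\<close>

lemma riesz_on_closed_subspace:
  fixes E :: "'a::{real_inner, banach} set" and \<phi> :: "'a \<Rightarrow> real"
  assumes sub: "subspace E" and cl: "closed E" and lin: "bounded_linear \<phi>"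
  obtains w where "w \<in> E" "\<And>x. x \<in> E \<Longrightarrow> \<phi> x = w \<bullet> x"
proof -
  interpret \<phi>: bounded_linear \<phi> by fact
  define J where "J x = x \<bullet> x / 2 - \<phi> x" for x
  obtain K where K: "\<And>x. norm (\<phi> x) \<le> norm x * K"
    using \<phi>.bounded by blast
  have J_ge: "J x \<ge> - (K\<^sup>2 / 2)" for x
  proof -
    have "\<phi> x \<le> norm x * K" using K[of x] by simp
    moreover have "0 \<le> (norm x - K)\<^sup>2" by simp
    ultimately show ?thesis
      by (simp add: J_def power2_diff flip: power2_norm_eq_inner)
  qed
  define m where "m = Inf (J ` E)"
  have bdd: "bdd_below (J ` E)" using J_ge by (auto intro!: bdd_belowI)
  have ne: "J ` E \<noteq> {}" using subspace_0[OF sub] by blast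
  have m_le: "m \<le> J x" if "x \<in> E" for x
    unfolding m_def using bdd that by (auto intro: cInf_lower)
  define \<delta> where "\<delta> n = inverse (real (Suc n))" for n
  have \<delta>: "\<delta> n > 0" "\<delta> \<longlonglongrightarrow> 0" for n
    unfolding \<delta>_def using LIMSEQ_inverse_real_of_nat by auto
  have "\<exists>x\<in>E. J x < m + \<delta> n" for n
    using cInf_lessD[OF ne, of "m + \<delta> n"] \<delta>(1) by (auto simp: m_def)
  then obtain s where sE: "\<And>n. s n \<in> E" and sJ: "\<And>n. J (s n) < m + \<delta> n"
    by metis
  have par: "(norm (x - y))\<^sup>2 = 4 * (J x + J y - 2 * J ((1/2) *\<^sub>R (x + y)))" for x y
    by (simp add: J_def power2_norm_eq_inner inner_diff_left inner_diff_right inner_add_left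
        inner_add_right \<phi>.scaleR \<phi>.add inner_commute field_simps)
  have "Cauchy s"
  proof (rule Cauchy_if_square_dist_le)
    fix i j
    have "(1/2) *\<^sub>R (s i + s j) \<in> E"
      using sE subspace_add[OF sub] subspace_scale[OF sub] by blast
    then have "m \<le> J ((1/2) *\<^sub>R (s i + s j))" by (rule m_le)
    then have "J (s i) + J (s j) - 2 * J ((1/2) *\<^sub>R (s i + s j)) \<le> \<delta> i + \<delta> j"
      using sJ[of i] sJ[of j] by auto
    then show "(norm (s i - s j))\<^sup>2 \<le> 4 * \<delta> i + 4 * \<delta> j"
      unfolding par[of "s i" "s j"] by auto
    show "(\<lambda>n. 4 * \<delta> n) \<longlonglongrightarrow> 0"
      using tendsto_mult_right_zero[OF \<delta>(2)] by blast
  qed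
  then obtain w where w: "s \<longlonglongrightarrow> w" using Cauchy_convergent convergent_def by blast
  have wE: "w \<in> E" using cl sE w closed_sequentially by blast
  have "(\<lambda>n. J (s n)) \<longlonglongrightarrow> J w"
    unfolding J_def by (intro tendsto_intros w \<phi>.tendsto) simp
  moreover have "(\<lambda>n. m + \<delta> n) \<longlonglongrightarrow> m + 0"
    by (intro tendsto_intros \<delta>(2))
  ultimately have "J w \<le> m + 0"
    by (rule LIMSEQ_le) (use sJ less_imp_le in blast)
  then have Jw: "J w \<le> m" by simp
  have "\<phi> x = w \<bullet> x" if x: "x \<in> E" for x
  proof (cases "x = 0")
    case False
    define g where "g = w \<bullet> x - \<phi> x"
    \<comment> \<open>The step that minimises \<open>J (w + t *\<^sub>R x) = J w + t g + t\<^sup>2 (x \<bullet> x) / 2\<close>.\<close>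
    define t where "t = - g / (x \<bullet> x)"
    have xx: "x \<bullet> x > 0" using False by simp
    have "w + t *\<^sub>R x \<in> E" using wE x sub by (simp add: subspace_add subspace_scale)
    then have "J w \<le> J (w + t *\<^sub>R x)" using Jw m_le by force
    moreover have "J (w + t *\<^sub>R x) = J w + (t * g + t * t * (x \<bullet> x) / 2)"
      by (simp add: J_def g_def inner_add_left inner_add_right \<phi>.add \<phi>.scaleR inner_commute
          algebra_simps)
    moreover have "t * g + t * t * (x \<bullet> x) / 2 = - (g\<^sup>2 / (2 * (x \<bullet> x)))"
      using xx by (simp add: t_def field_simps power2_eq_square)
    ultimately have "g\<^sup>2 / (2 * (x \<bullet> x)) \<le> 0" by auto
    then have "g = 0" using xx by (simp add: divide_le_0_iff)
    then show ?thesis by (simp add: g_def)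
  qed simp
  with wE that show ?thesis by blast
qed

text \<open>
  \<open>adjoint\<close> picks some map satisfying the duality relation; Riesz representation provides one.
\<close>

lemma inner_adjoint:
  fixes f :: "'a::{real_inner, banach} \<Rightarrow> 'b::real_inner"
  assumes "bounded_linear f"
  shows "x \<bullet> adjoint f y = f x \<bullet> y"
proof -
  have "\<exists>w. \<forall>x. f x \<bullet> y = x \<bullet> w" for y
  proof -
    have lin: "bounded_linear (\<lambda>x. f x \<bullet> y)"
      using bounded_linear_compose[OF bounded_linear_inner_left assms] .
    then obtain w where "\<And>x. f x \<bullet> y = w \<bullet> x"
      using riesz_on_closed_subspace[OF subspace_UNIV closed_UNIV lin] by (metis UNIV_I)
    then show ?thesis by (auto simp: inner_commute)
  qed
  then obtain g where g: "\<And>x y. f x \<bullet> y = x \<bullet> g y" by metis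
  then show ?thesis using adjoint_unique[of f g] by simp
qed

lemma bounded_linear_adjoint:
  fixes f :: "'a::{real_inner, banach} \<Rightarrow> 'b::real_inner"
  assumes f: "bounded_linear f"
  shows "bounded_linear (adjoint f)"
proof -
  have ext: "u = v" if "\<And>x::'a. x \<bullet> u = x \<bullet> v" for u v
    by (rule vector_eq_rdot[THEN iffD1, rule_format]) (metis that inner_commute)
  obtain K where K: "K \<ge> 0" "\<And>x. norm (f x) \<le> norm x * K"
    using bounded_linear.nonneg_bounded[OF f] by blast
  show ?thesis
  proof (rule bounded_linear_intro)
    show "adjoint f (x + y) = adjoint f x + adjoint f y" for x y
      by (rule ext) (simp add: inner_add_right inner_adjoint[OF f])
    show "adjoint f (r *\<^sub>R x) = r *\<^sub>R adjoint f x" for r x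
      by (rule ext) (simp add: inner_adjoint[OF f])
    show "norm (adjoint f y) \<le> norm y * K" for y
    proof -
      let ?a = "adjoint f y"
      have "norm ?a * norm ?a = f ?a \<bullet> y"
        by (simp add: inner_adjoint[OF f, symmetric] flip: power2_norm_eq_inner power2_eq_square)
      also have "\<dots> \<le> norm (f ?a) * norm y" by (rule norm_cauchy_schwarz)
      also have "\<dots> \<le> norm ?a * K * norm y" using K by (intro mult_right_mono) auto
      finally have "norm ?a * norm ?a \<le> norm ?a * (norm y * K)" by (simp add: ac_simps)
      then show ?thesis using K(1)
        by (cases "norm ?a = 0") (auto intro: mult_nonneg_nonneg)
    qed
  qed
qed

lemma closed_orthogonal_comp: "closed (orthogonal_comp N)"
proof -
  have "orthogonal_comp N = (\<Inter>y\<in>N. {x. y \<bullet> x = 0})"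
    by (auto simp: orthogonal_comp_def orthogonal_def)
  also have "closed \<dots>"
    by (intro closed_INT ballI closed_Collect_eq continuous_intros)
  finally show ?thesis .
qed

lemma orth_proj_eqI:
  assumes "subspace E" "p \<in> E" "x - p \<in> orthogonal_comp E"
  shows "orth_proj E x = p"
  unfolding orth_proj_def
proof (rule the_equality)
  fix q assume q: "q \<in> E \<and> x - q \<in> orthogonal_comp E"
  have d: "q - p \<in> E" using q assms by (simp add: subspace_diff)
  have "(x - p) - (x - q) \<in> orthogonal_comp E"
    using q assms subspace_diff[OF subspace_orthogonal_comp] by blast
  then have "(q - p) \<bullet> (q - p) = 0"
    using d by (auto simp: orthogonal_comp_def orthogonal_def)
  then show "q = p" by simp
qed (use assms in auto)

lemma orth_proj_UNIV: "orth_proj UNIV x = x"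
  by (rule orth_proj_eqI) (auto simp: subspace_UNIV)

lemma orth_proj_mem:
  fixes E :: "'a::{real_inner, banach} set"
  assumes "subspace E" "closed E"
  shows "orth_proj E x \<in> E" "x - orth_proj E x \<in> orthogonal_comp E"
proof -
  obtain p where p: "p \<in> E" "\<And>e. e \<in> E \<Longrightarrow> x \<bullet> e = p \<bullet> e"
    using riesz_on_closed_subspace[OF assms bounded_linear_inner_right[of x]] by metis
  then have "x - p \<in> orthogonal_comp E"
    by (auto simp: orthogonal_comp_def orthogonal_def inner_diff_right inner_commute)
  then show "orth_proj E x \<in> E" "x - orth_proj E x \<in> orthogonal_comp E"
    using orth_proj_eqI[OF assms(1) p(1)] p(1) by auto
qed

text \<open>
  The projection \<open>p\<close> of \<open>u\<close> satisfies \<open>\<parallel>p\<parallel>\<^sup>2 = p \<bullet> u = p \<bullet> (u - y)\<close>. Hence convergence of a sequence to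
  a point of \<open>N\<close> makes the projections onto the complement of \<open>N\<close> tend to zero.
\<close>

lemma norm_orth_proj_orthogonal_comp_le:
  fixes N :: "'a::{real_inner, banach} set"
  assumes "y \<in> N"
  shows "norm (orth_proj (orthogonal_comp N) u) \<le> norm (u - y)"
proof -
  let ?p = "orth_proj (orthogonal_comp N) u"
  have p: "?p \<in> orthogonal_comp N" "u - ?p \<in> orthogonal_comp (orthogonal_comp N)"
    by (intro orth_proj_mem subspace_orthogonal_comp closed_orthogonal_comp)+
  have "?p \<bullet> ?p = ?p \<bullet> u"
    using p by (auto simp: orthogonal_comp_def orthogonal_def inner_diff_right)
  moreover have "?p \<bullet> y = 0"
    using p(1) assms by (auto simp: orthogonal_comp_def orthogonal_def inner_commute)
  ultimately have "norm ?p * norm ?p = ?p \<bullet> (u - y)"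
    by (simp add: inner_diff_right flip: power2_norm_eq_inner power2_eq_square)
  also have "\<dots> \<le> norm ?p * norm (u - y)" by (rule norm_cauchy_schwarz)
  finally show ?thesis by (cases "norm ?p = 0") auto
qed

text \<open>
  With \<open>L = Q \<circ> P\<close> symmetric, the moments \<open>a k = L\<^sup>k x \<bullet> x\<close> satisfy \<open>L\<^sup>i x \<bullet> L\<^sup>j x = a (i + j)\<close>, and
  they decrease: \<open>a (2 k)\<close> and \<open>a (2 k + 1)\<close> are the squared norms of \<open>v = L\<^sup>k x\<close> and of \<open>P v\<close>, and
  \<open>\<parallel>Q (P v)\<parallel> \<le> \<parallel>P v\<parallel> \<le> \<parallel>v\<parallel>\<close>. Convergence of the moments
  makes \<open>L\<^sup>k x\<close> a Cauchy sequence, and its limit is fixed by \<open>L\<close>.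
\<close>

lemma powers_of_adjoint_comp_contraction_converge:
  fixes P Q :: "'a::{real_inner, banach} \<Rightarrow> 'a"
  assumes adj: "\<And>x y. P x \<bullet> y = x \<bullet> Q y"
    and contr: "\<And>x. norm (P x) \<le> norm x"
    and P: "bounded_linear P" and Q: "bounded_linear Q"
  shows "\<exists>y. (\<lambda>n. ((Q \<circ> P) ^^ n) x) \<longlonglongrightarrow> y \<and> Q (P y) = y"
proof -
  define L where "L = Q \<circ> P"
  define a where "a k = (L ^^ k) x \<bullet> x" for k
  have symL: "(L ^^ k) u \<bullet> v = u \<bullet> (L ^^ k) v" for k u v
  proof (induction k arbitrary: u)
    case (Suc k)
    have "L w \<bullet> v' = w \<bullet> L v'" for w v'
      unfolding L_def comp_def by (metis adj inner_commute)
    then show ?case using Suc by (simp add: funpow_swap1)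
  qed simp
  have mom: "(L ^^ i) x \<bullet> (L ^^ j) x = a (i + j)" for i j
    using symL[of j "(L ^^ i) x" x] by (simp add: a_def funpow_add add.commute[of i j])
  have Qcontr: "norm (Q z) \<le> norm z" for z
  proof -
    have "norm (Q z) * norm (Q z) = P (Q z) \<bullet> z"
      by (simp add: adj flip: power2_norm_eq_inner power2_eq_square)
    also have "\<dots> \<le> norm (P (Q z)) * norm z" by (rule norm_cauchy_schwarz)
    also have "\<dots> \<le> norm (Q z) * norm z" by (intro mult_right_mono contr) simp
    finally show ?thesis by (cases "norm (Q z) = 0") auto
  qed
  have even_moment: "a (2 * k) = (norm ((L ^^ k) x))\<^sup>2" for k
    using mom[of k k] by (simp add: power2_norm_eq_inner mult_2)
  have odd_moment: "a (Suc (2 * k)) = (norm (P ((L ^^ k) x)))\<^sup>2" for k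
    using mom[of k "Suc k"] by (simp add: L_def adj power2_norm_eq_inner mult_2)
  have a_Suc: "a (Suc k) \<le> a k" for k
  proof (cases "even k")
    case True
    then obtain j where "k = 2 * j" by blast
    then show ?thesis using contr by (simp add: even_moment odd_moment power_mono)
  next
    case False
    then obtain j where k: "k = Suc (2 * j)" using oddE by fastforce
    have "a (Suc k) = (norm (Q (P ((L ^^ j) x))))\<^sup>2"
      using even_moment[of "Suc j"] k by (simp add: L_def)
    then show ?thesis using Qcontr k by (simp add: odd_moment power_mono)
  qed
  have dec: "decseq a" using a_Suc by (simp add: decseq_Suc_iff)
  have a_nonneg: "0 \<le> a k" for k
  proof (cases "even k")
    case True
    then obtain j where "k = 2 * j" by blast
    then show ?thesis by (simp add: even_moment)
  next
    case False
    then obtain j where "k = Suc (2 * j)" using oddE by fastforce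
    then show ?thesis by (simp add: odd_moment)
  qed
  obtain l where l: "a \<longlonglongrightarrow> l" and l_le: "\<And>k. l \<le> a k"
    using decseq_convergent[OF dec, of 0] a_nonneg by blast
  have "Cauchy (\<lambda>n. (L ^^ n) x)"
  proof (rule Cauchy_if_square_dist_le)
    fix i j
    have "(norm ((L ^^ i) x - (L ^^ j) x))\<^sup>2 = a (i + i) - 2 * a (i + j) + a (j + j)"
      unfolding power2_norm_eq_inner inner_diff_left inner_diff_right mom
      by (simp add: add.commute)
    then show "(norm ((L ^^ i) x - (L ^^ j) x))\<^sup>2 \<le> (a (i + i) - l) + (a (j + j) - l)"
      using l_le[of "i + j"] by linarith
    have "filterlim (\<lambda>n::nat. n + n) at_top sequentially"
      by (auto intro!: filterlim_subseq simp: strict_mono_def)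
    then have "(\<lambda>n. a (n + n)) \<longlonglongrightarrow> l" using filterlim_compose[OF l] by blast
    then show "(\<lambda>n. a (n + n) - l) \<longlonglongrightarrow> 0" by (simp add: LIM_zero)
  qed
  then obtain y where y: "(\<lambda>n. (L ^^ n) x) \<longlonglongrightarrow> y"
    using Cauchy_convergent convergent_def by blast
  have "(\<lambda>n. Q (P ((L ^^ n) x))) \<longlonglongrightarrow> Q (P y)"
    using y by (intro bounded_linear.tendsto[OF Q] bounded_linear.tendsto[OF P])
  moreover have "(\<lambda>n. Q (P ((L ^^ n) x))) \<longlonglongrightarrow> y"
    using LIMSEQ_Suc[OF y] by (simp add: L_def)
  ultimately have "Q (P y) = y" using LIMSEQ_unique by blast
  with y show ?thesis unfolding L_def by blast
qed

lemma linear_eq_if_eq_on_dense: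
  assumes D: "closure D = UNIV" and f: "bounded_linear f" and g: "bounded_linear g"
    and eq: "\<And>x. x \<in> D \<Longrightarrow> f x = g x"
  shows "f x = g x"
proof -
  have "continuous_on (closure D) (\<lambda>x. f x - g x)"
    by (intro continuous_intros linear_continuous_on f g)
  from continuous_constant_on_closure[OF this, of 0 x] show ?thesis
    using D eq by simp
qed

text \<open>Baire: one of the closed sets \<open>{x. \<forall>i\<in>I. \<parallel>V i x\<parallel> \<le> n}\<close>, which cover the space, contains a ball.\<close>

lemma banach_steinhaus:
  fixes V :: "'i \<Rightarrow> 'a::banach \<Rightarrow> 'b::real_normed_vector"
  assumes lin: "\<And>i. i \<in> I \<Longrightarrow> bounded_linear (V i)"
    and pt: "\<And>x. \<exists>c. \<forall>i\<in>I. norm (V i x) \<le> c"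
  obtains M where "M \<ge> 0" "\<And>i x. i \<in> I \<Longrightarrow> norm (V i x) \<le> M * norm x"
proof -
  define F where "F n = {x. \<forall>i\<in>I. norm (V i x) \<le> real n}" for n
  have closedF: "closed (F n)" for n
  proof -
    have "F n = (\<Inter>i\<in>I. {x. norm (V i x) \<le> real n})" by (auto simp: F_def)
    also have "closed \<dots>"
      by (intro closed_INT ballI closed_Collect_le continuous_intros linear_continuous_on lin)
    finally show ?thesis .
  qed
  have cover: "(\<Union>n. F n) = UNIV"
  proof -
    have "\<exists>n. x \<in> F n" for x
    proof -
      obtain c where c: "\<forall>i\<in>I. norm (V i x) \<le> c" using pt by blast
      obtain n where "c \<le> real n" using real_arch_simple by blast
      with c have "x \<in> F n" by (auto simp: F_def intro: order_trans)
      then show ?thesis ..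
    qed
    then show ?thesis by blast
  qed
  have "\<exists>n. interior (F n) \<noteq> {}"
  proof (rule ccontr)
    assume *: "\<nexists>n. interior (F n) \<noteq> {}"
    have "euclidean interior_of \<Union> (range F) = ({}::'a set)"
      by (rule Baire_category_alt) (use * closedF in \<open>auto simp: completely_metrizable_space_euclidean\<close>)
    then show False using cover by simp
  qed
  then obtain n x0 where "x0 \<in> interior (F n)" by blast
  then obtain e where e: "e > 0" and ball: "cball x0 e \<subseteq> F n"
    using mem_interior_cball by blast
  show thesis
  proof (rule that)
    show "0 \<le> 2 * real n / e" using e by simp
    fix i x assume i: "i \<in> I"
    interpret bounded_linear "V i" using lin i by blast
    show "norm (V i x) \<le> 2 * real n / e * norm x"
    proof (cases "x = 0")
      case False
      define h where "h = (e / norm x) *\<^sub>R x"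
      have bound: "norm (V i v) \<le> n" if "v \<in> cball x0 e" for v
        using ball i that unfolding F_def by blast
      have "norm (V i (x0 + h)) \<le> n" "norm (V i x0) \<le> n"
        using e False by (auto intro!: bound simp: h_def dist_norm)
      moreover have "V i h = V i (x0 + h) - V i x0" by (simp add: add)
      ultimately have "norm (V i h) \<le> 2 * n"
        using norm_triangle_ineq4[of "V i (x0 + h)" "V i x0"] by simp
      moreover have "norm (V i h) = e / norm x * norm (V i x)"
        using e by (simp add: h_def scaleR)
      ultimately show ?thesis using e False by (simp add: field_simps)
    qed (simp add: zero)
  qed
qed

section \<open>Evolution systems in both time directions\<close>

text \<open>
  Every \<open>V t s\<close> factors as \<open>V t 0 \<circ> V 0 s\<close> and as \<open>V t T \<circ> V T s\<close>. This transports the properties of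
  the evolution system on the triangle \<open>s \<le> t\<close>, where the derivatives are one-sided, to the square.
\<close>

lemma generates_bidirectional_bounded_linear:
  assumes "generates_bidirectional T D B V" "t \<in> {0..T}" "s \<in> {0..T}"
  shows "bounded_linear (V t s)"
  using assms unfolding generates_bidirectional_def bidirectional_evolution_system_def by blast

lemma generates_bidirectional_comp:
  assumes "generates_bidirectional T D B V" "t \<in> {0..T}" "s \<in> {0..T}" "\<sigma> \<in> {0..T}"
  shows "V t s (V s \<sigma> x) = V t \<sigma> x"
  using assms unfolding generates_bidirectional_def bidirectional_evolution_system_def
  by (metis comp_apply)

lemma generates_bidirectional_refl:
  assumes "generates_bidirectional T D B V" "t \<in> {0..T}"
  shows "V t t x = x"
  using assms unfolding generates_bidirectional_def bidirectional_evolution_system_def by auto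

lemma generates_bidirectional_domain:
  assumes gen: "generates_bidirectional T D B V" and ts: "t \<in> {0..T}" "s \<in> {0..T}" and x: "x \<in> D"
  shows "V t s x \<in> D"
proof -
  have fwd: "generates_evolution_system T D B V"
    and bwd: "generates_evolution_system T D (\<lambda>t x. - B (T - t) x) (\<lambda>t s. V (T - t) (T - s))"
    using gen unfolding generates_bidirectional_def by auto
  have "\<forall>s t. 0 \<le> s \<and> s \<le> t \<and> t \<le> T \<longrightarrow> (\<forall>x\<in>D. V (T - t) (T - s) x \<in> D)"
    using bwd unfolding generates_evolution_system_def by blast
  from this[rule_format, of "T - s" T x] have "V 0 s x \<in> D" using ts x by simp
  then have "V t 0 (V 0 s x) \<in> D"
    using fwd ts unfolding generates_evolution_system_def by force
  then show ?thesis using generates_bidirectional_comp[OF gen, of t 0 s x] ts by simp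
qed

lemma generates_bidirectional_deriv_fst:
  assumes gen: "generates_bidirectional T D B V" and ts: "t \<in> {0..T}" "s \<in> {0..T}" and x: "x \<in> D"
  shows "((\<lambda>\<tau>. V \<tau> s x) has_vector_derivative B t (V t s x)) (at t within {0..T})"
proof -
  have zero: "0 \<in> {0..T}" using ts by auto
  have fwd: "generates_evolution_system T D B V"
    using gen unfolding generates_bidirectional_def by auto
  have "V 0 s x \<in> D" using generates_bidirectional_domain[OF gen zero ts(2) x] .
  then have "((\<lambda>\<tau>. V \<tau> 0 (V 0 s x)) has_vector_derivative B t (V t 0 (V 0 s x)))
      (at t within {0..T})"
    using fwd ts unfolding generates_evolution_system_def by force
  then have "((\<lambda>\<tau>. V \<tau> 0 (V 0 s x)) has_vector_derivative B t (V t s x)) (at t within {0..T})"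
    by (simp add: generates_bidirectional_comp[OF gen ts(1) zero ts(2)])
  then show ?thesis
    by (rule has_vector_derivative_transform[OF ts(1), rotated])
      (simp add: generates_bidirectional_comp[OF gen _ zero ts(2)])
qed

lemma generates_bidirectional_deriv_snd:
  assumes gen: "generates_bidirectional T D B V" and ts: "t \<in> {0..T}" "s \<in> {0..T}" and x: "x \<in> D"
  shows "((\<lambda>\<sigma>. V t \<sigma> x) has_vector_derivative - V t s (B s x)) (at s within {0..T})"
proof -
  have last: "T \<in> {0..T}" using ts by auto
  have fwd: "generates_evolution_system T D B V"
    using gen unfolding generates_bidirectional_def by auto
  interpret V: bounded_linear "V t T"
    using generates_bidirectional_bounded_linear[OF gen ts(1) last] .
  have "((\<lambda>\<sigma>. V T \<sigma> x) has_vector_derivative - V T s (B s x)) (at s within {0..T})"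
    using fwd ts x unfolding generates_evolution_system_def by force
  from V.has_vector_derivative[OF this]
  have "((\<lambda>\<sigma>. V t T (V T \<sigma> x)) has_vector_derivative - V t s (B s x)) (at s within {0..T})"
    by (simp add: V.neg generates_bidirectional_comp[OF gen ts(1) last ts(2)])
  then show ?thesis
    by (rule has_vector_derivative_transform[OF ts(2), rotated])
      (simp add: generates_bidirectional_comp[OF gen ts(1) last])
qed

lemma generates_bidirectional_continuous_fst:
  assumes gen: "generates_bidirectional T D B V" and s: "s \<in> {0..T}"
  shows "continuous_on {0..T} (\<lambda>t. V t s x)"
proof -
  have zero: "0 \<in> {0..T}" using s by auto
  have "continuous_on {(t, s). 0 \<le> s \<and> s \<le> t \<and> t \<le> T} (\<lambda>(t, s). V t s (V 0 s' x))" for s'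
    using gen unfolding generates_bidirectional_def generates_evolution_system_def
      evolution_system_def by blast
  then have "continuous_on {0..T} (\<lambda>t. (\<lambda>(t, s'). V t s' (V 0 s x)) (t, 0))"
    by (rule continuous_on_compose2) (auto intro!: continuous_intros)
  then have "continuous_on {0..T} (\<lambda>t. V t 0 (V 0 s x))" by simp
  then show ?thesis
    by (rule continuous_on_eq) (simp add: generates_bidirectional_comp[OF gen _ zero s])
qed

lemma generates_bidirectional_continuous_snd:
  assumes gen: "generates_bidirectional T D B V" and t: "t \<in> {0..T}"
  shows "continuous_on {0..T} (\<lambda>s. V t s x)"
proof -
  have last: "T \<in> {0..T}" using t by auto
  have "continuous_on {(t, s). 0 \<le> s \<and> s \<le> t \<and> t \<le> T} (\<lambda>(t, s). V t s x)"
    using gen unfolding generates_bidirectional_def generates_evolution_system_def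
      evolution_system_def by blast
  then have "continuous_on {0..T} (\<lambda>s. (\<lambda>(t, s). V t s x) (T, s))"
    by (rule continuous_on_compose2) (auto intro!: continuous_intros)
  then have "continuous_on {0..T} (\<lambda>s. V T s x)" by simp
  then have "continuous_on {0..T} (\<lambda>s. V t T (V T s x))"
    using bounded_linear.continuous_on[OF generates_bidirectional_bounded_linear[OF gen t last]]
    by blast
  then show ?thesis
    by (rule continuous_on_eq) (simp add: generates_bidirectional_comp[OF gen t last])
qed

text \<open>
  Strong continuity on the compact interval bounds \<open>V t 0 x\<close> and \<open>V 0 s x\<close> for each \<open>x\<close>, so the uniform
  boundedness principle applies to both factors of \<open>V t s = V t 0 \<circ> V 0 s\<close>.
\<close>

lemma generates_bidirectional_uniformly_bounded:
  fixes V :: "real \<Rightarrow> real \<Rightarrow> 'a::banach \<Rightarrow> 'a"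
  assumes gen: "generates_bidirectional T D B V"
  obtains M where "M \<ge> 0"
    "\<And>t s x. t \<in> {0..T} \<Longrightarrow> s \<in> {0..T} \<Longrightarrow> norm (V t s x) \<le> M * norm x"
proof (cases "0 \<le> T")
  case True
  then have zero: "0 \<in> {0..T}" by simp
  have bnd: "\<exists>c. \<forall>t\<in>{0..T}. norm (f t) \<le> c"
    if "continuous_on {0..T} f" for f :: "real \<Rightarrow> 'a"
    using compact_imp_bounded[OF compact_continuous_image[OF that compact_Icc]]
    by (auto simp: bounded_iff)
  obtain M1 where M1: "M1 \<ge> 0" "\<And>t x. t \<in> {0..T} \<Longrightarrow> norm (V t 0 x) \<le> M1 * norm x"
    using banach_steinhaus[of "{0..T}" "\<lambda>t. V t 0"]
      generates_bidirectional_bounded_linear[OF gen _ zero]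
      bnd[OF generates_bidirectional_continuous_fst[OF gen zero]] by metis
  obtain M2 where M2: "M2 \<ge> 0" "\<And>s x. s \<in> {0..T} \<Longrightarrow> norm (V 0 s x) \<le> M2 * norm x"
    using banach_steinhaus[of "{0..T}" "\<lambda>s. V 0 s"]
      generates_bidirectional_bounded_linear[OF gen zero]
      bnd[OF generates_bidirectional_continuous_snd[OF gen zero]] by metis
  show thesis
  proof (rule that)
    show "0 \<le> M1 * M2" using M1 M2 by simp
    fix t s x assume ts: "t \<in> {0..T}" "s \<in> {0..T}"
    have "norm (V t s x) = norm (V t 0 (V 0 s x))"
      using generates_bidirectional_comp[OF gen ts(1) zero ts(2)] by simp
    also have "\<dots> \<le> M1 * norm (V 0 s x)" using M1 ts by blast
    also have "\<dots> \<le> M1 * (M2 * norm x)" using M1 M2 ts by (intro mult_left_mono) auto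
    finally show "norm (V t s x) \<le> M1 * M2 * norm x" by (simp add: mult.assoc)
  qed
qed (use that[of 0] in auto)

section \<open>Duhamel's formula and its consequences\<close>

lemma has_vector_derivative_iff_quotient:
  "(f has_vector_derivative d) (at x within S) \<longleftrightarrow>
     ((\<lambda>y. (f y - f x) /\<^sub>R (y - x)) \<longlongrightarrow> d) (at x within S)"
proof -
  have "norm (f y - f x - (y - x) *\<^sub>R d) / norm (y - x) = norm ((f y - f x) /\<^sub>R (y - x) - d)"
    if "y \<noteq> x" for y
  proof -
    have "(f y - f x) /\<^sub>R (y - x) - d = (f y - f x - (y - x) *\<^sub>R d) /\<^sub>R (y - x)"
      using that by (simp add: scaleR_diff_right)
    then show ?thesis by (simp add: divide_inverse_commute)
  qed
  then have "((\<lambda>y. norm (f y - f x - (y - x) *\<^sub>R d) / norm (y - x)) \<longlongrightarrow> 0) (at x within S) \<longleftrightarrow>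
      ((\<lambda>y. norm ((f y - f x) /\<^sub>R (y - x) - d)) \<longlongrightarrow> 0) (at x within S)"
    by (intro tendsto_cong) (auto simp: eventually_at_filter)
  then show ?thesis
    unfolding has_vector_derivative_def has_derivative_iff_norm
    by (simp add: bounded_linear_scaleR_left tendsto_norm_zero_iff LIM_zero_iff)
qed

lemma tendsto_strongly_continuous_apply:
  fixes V :: "'t \<Rightarrow> 'a::real_normed_vector \<Rightarrow> 'b::real_normed_vector"
  assumes lin: "\<And>t. t \<in> S \<Longrightarrow> linear (V t)"
    and M: "\<And>t y. t \<in> S \<Longrightarrow> norm (V t y) \<le> M * norm y"
    and ev: "\<forall>\<^sub>F t in F. t \<in> S"
    and w: "(w \<longlongrightarrow> l) F" and V: "((\<lambda>t. V t l) \<longlongrightarrow> v) F"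
  shows "((\<lambda>t. V t (w t)) \<longlongrightarrow> v) F"
proof -
  have "((\<lambda>t. M * norm (w t - l)) \<longlongrightarrow> 0) F"
    by (intro tendsto_mult_right_zero tendsto_norm_zero LIM_zero w)
  moreover have "\<forall>\<^sub>F t in F. norm (V t (w t) - V t l) \<le> M * norm (w t - l)"
    using ev by eventually_elim (metis lin M linear_diff)
  ultimately have "((\<lambda>t. V t (w t) - V t l) \<longlongrightarrow> 0) F"
    by (rule Lim_null_comparison[rotated])
  from tendsto_add[OF this V] show ?thesis by simp
qed

text \<open>
  The perturbation \<open>R\<close> is the difference of the two generators. On the domain the formula integrates
  the derivative of \<open>\<sigma> \<mapsto> V t \<sigma> (U \<sigma> s x)\<close>. Only \<open>R\<close> and the two evolution systems occur in the
  integrand, and all of them are bounded, so both sides extend continuously from the dense domain.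
\<close>

lemma duhamel:
  fixes U V :: "real \<Rightarrow> real \<Rightarrow> 'a::banach \<Rightarrow> 'a"
  assumes gU: "generates_bidirectional T D B U" and gV: "generates_bidirectional T D B' V"
    and dense: "closure D = UNIV" and R: "bounded_linear R"
    and BB': "\<And>\<tau> x. \<tau> \<in> {0..T} \<Longrightarrow> x \<in> D \<Longrightarrow> B \<tau> x = B' \<tau> x + R x"
    and ts: "t \<in> {0..T}" "s \<in> {0..T}" and ab: "0 \<le> a" "a \<le> b" "b \<le> T"
  shows "((\<lambda>\<sigma>. V t \<sigma> (R (U \<sigma> s x))) has_integral V t b (U b s x) - V t a (U a s x)) {a..b}"
proof -
  obtain MU where MU: "MU \<ge> 0"
    "\<And>t s x. t \<in> {0..T} \<Longrightarrow> s \<in> {0..T} \<Longrightarrow> norm (U t s x) \<le> MU * norm x"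
    using generates_bidirectional_uniformly_bounded[OF gU] by blast
  obtain MV where MV: "MV \<ge> 0"
    "\<And>t s x. t \<in> {0..T} \<Longrightarrow> s \<in> {0..T} \<Longrightarrow> norm (V t s x) \<le> MV * norm x"
    using generates_bidirectional_uniformly_bounded[OF gV] by blast
  obtain MR where MR: "MR \<ge> 0" "\<And>x. norm (R x) \<le> norm x * MR"
    using bounded_linear.nonneg_bounded[OF R] by blast
  note Ulin = generates_bidirectional_bounded_linear[OF gU]
  note Vlin = generates_bidirectional_bounded_linear[OF gV]
  have limV: "((\<lambda>\<sigma>. V t \<sigma> (w \<sigma>)) \<longlongrightarrow> V t \<tau> l) (at \<tau> within {0..T})"
    if \<tau>: "\<tau> \<in> {0..T}" and w: "(w \<longlongrightarrow> l) (at \<tau> within {0..T})" for w \<tau> l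
  proof (rule tendsto_strongly_continuous_apply[OF _ _ _ w])
    show "linear (V t \<sigma>)" if "\<sigma> \<in> {0..T}" for \<sigma>
      using Vlin[OF ts(1) that] bounded_linear.linear by blast
    show "norm (V t \<sigma> y) \<le> MV * norm y" if "\<sigma> \<in> {0..T}" for \<sigma> y
      using MV(2)[OF ts(1) that] .
    show "\<forall>\<^sub>F \<sigma> in at \<tau> within {0..T}. \<sigma> \<in> {0..T}"
      by (simp add: eventually_at_filter)
    show "((\<lambda>\<sigma>. V t \<sigma> l) \<longlongrightarrow> V t \<tau> l) (at \<tau> within {0..T})"
      using generates_bidirectional_continuous_snd[OF gV ts(1)] \<tau>
      by (simp add: continuous_on_def)
  qed
  have cont: "continuous_on {a..b} (\<lambda>\<sigma>. V t \<sigma> (R (U \<sigma> s x)))" for x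
  proof -
    have "continuous_on {0..T} (\<lambda>\<sigma>. R (U \<sigma> s x))"
      using bounded_linear.continuous_on[OF R generates_bidirectional_continuous_fst[OF gU ts(2)]] .
    then have "continuous_on {0..T} (\<lambda>\<sigma>. V t \<sigma> (R (U \<sigma> s x)))"
      unfolding continuous_on_def using limV by blast
    then show ?thesis by (rule continuous_on_subset) (use ab in auto)
  qed
  have deriv: "((\<lambda>\<sigma>. V t \<sigma> (U \<sigma> s x)) has_vector_derivative V t \<tau> (R (U \<tau> s x)))
      (at \<tau> within {0..T})" if x: "x \<in> D" and \<tau>: "\<tau> \<in> {0..T}" for x \<tau>
  proof -
    define u where "u \<sigma> = U \<sigma> s x" for \<sigma>
    have uD: "u \<sigma> \<in> D" if "\<sigma> \<in> {0..T}" for \<sigma>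
      unfolding u_def using generates_bidirectional_domain[OF gU that ts(2) x] .
    have "((\<lambda>\<sigma>. (u \<sigma> - u \<tau>) /\<^sub>R (\<sigma> - \<tau>)) \<longlongrightarrow> B \<tau> (u \<tau>)) (at \<tau> within {0..T})"
      using generates_bidirectional_deriv_fst[OF gU \<tau> ts(2) x]
      by (simp add: u_def has_vector_derivative_iff_quotient)
    from limV[OF \<tau> this]
    have 1: "((\<lambda>\<sigma>. V t \<sigma> ((u \<sigma> - u \<tau>) /\<^sub>R (\<sigma> - \<tau>))) \<longlongrightarrow> V t \<tau> (B \<tau> (u \<tau>))) (at \<tau> within {0..T})" .
    \<comment> \<open>\<open>V t \<sigma> (u \<sigma>) - V t \<tau> (u \<tau>)\<close> splits into \<open>V t \<sigma> (u \<sigma> - u \<tau>)\<close>, controlled by the strong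
      continuity and the uniform bound of \<open>V t\<close>, and the increment of \<open>V t\<close> at the fixed domain vector \<open>u \<tau>\<close>.\<close>
    have 2: "((\<lambda>\<sigma>. (V t \<sigma> (u \<tau>) - V t \<tau> (u \<tau>)) /\<^sub>R (\<sigma> - \<tau>)) \<longlongrightarrow> - V t \<tau> (B' \<tau> (u \<tau>)))
        (at \<tau> within {0..T})"
      using generates_bidirectional_deriv_snd[OF gV ts(1) \<tau> uD[OF \<tau>]]
      by (simp add: has_vector_derivative_iff_quotient)
    have sum: "V t \<tau> (B \<tau> (u \<tau>)) + - V t \<tau> (B' \<tau> (u \<tau>)) = V t \<tau> (R (u \<tau>))"
      using BB'[OF \<tau> uD[OF \<tau>]] by (simp add: linear_simps(1)[OF Vlin[OF ts(1) \<tau>]])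
    have "((\<lambda>\<sigma>. (V t \<sigma> (u \<sigma>) - V t \<tau> (u \<tau>)) /\<^sub>R (\<sigma> - \<tau>)) \<longlongrightarrow> V t \<tau> (R (u \<tau>)))
        (at \<tau> within {0..T})"
    proof (rule Lim_transform_eventually)
      show "((\<lambda>\<sigma>. V t \<sigma> ((u \<sigma> - u \<tau>) /\<^sub>R (\<sigma> - \<tau>)) + (V t \<sigma> (u \<tau>) - V t \<tau> (u \<tau>)) /\<^sub>R (\<sigma> - \<tau>))
          \<longlongrightarrow> V t \<tau> (R (u \<tau>))) (at \<tau> within {0..T})"
        using tendsto_add[OF 1 2] unfolding sum .
      have "V t \<sigma> ((u \<sigma> - u \<tau>) /\<^sub>R (\<sigma> - \<tau>)) = (V t \<sigma> (u \<sigma>) - V t \<sigma> (u \<tau>)) /\<^sub>R (\<sigma> - \<tau>)"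
        if "\<sigma> \<in> {0..T}" for \<sigma>
        using linear_simps(2,5)[OF Vlin[OF ts(1) that]] by simp
      then show "\<forall>\<^sub>F \<sigma> in at \<tau> within {0..T}. V t \<sigma> ((u \<sigma> - u \<tau>) /\<^sub>R (\<sigma> - \<tau>)) +
          (V t \<sigma> (u \<tau>) - V t \<tau> (u \<tau>)) /\<^sub>R (\<sigma> - \<tau>) = (V t \<sigma> (u \<sigma>) - V t \<tau> (u \<tau>)) /\<^sub>R (\<sigma> - \<tau>)"
        by (auto simp: eventually_at_filter simp flip: scaleR_add_right)
    qed
    then show ?thesis by (simp add: has_vector_derivative_iff_quotient u_def)
  qed
  have abT: "a \<in> {0..T}" "b \<in> {0..T}" "\<And>\<sigma>. \<sigma> \<in> {a..b} \<Longrightarrow> \<sigma> \<in> {0..T}" using ab by auto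
  define I where "I x = integral {a..b} (\<lambda>\<sigma>. V t \<sigma> (R (U \<sigma> s x)))" for x
  have int: "((\<lambda>\<sigma>. V t \<sigma> (R (U \<sigma> s x))) has_integral I x) {a..b}" for x
    unfolding I_def using integrable_continuous_real[OF cont] by (rule integrable_integral)
  have integrand_lin: "bounded_linear (\<lambda>x. V t \<sigma> (R (U \<sigma> s x)))" if "\<sigma> \<in> {0..T}" for \<sigma>
    using bounded_linear_compose[OF Vlin[OF ts(1) that] bounded_linear_compose[OF R Ulin[OF that ts(2)]]]
    by simp
  have I_lin: "bounded_linear I"
  proof (rule bounded_linear_intro)
    fix x y :: 'a and r :: real
    have "((\<lambda>\<sigma>. V t \<sigma> (R (U \<sigma> s (x + y)))) has_integral I x + I y) {a..b}"
      by (rule has_integral_eq[OF _ has_integral_add[OF int int]])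
        (simp add: linear_simps(1)[OF integrand_lin[OF abT(3)]])
    then show "I (x + y) = I x + I y" using int has_integral_unique by blast
    have "((\<lambda>\<sigma>. V t \<sigma> (R (U \<sigma> s (r *\<^sub>R x)))) has_integral r *\<^sub>R I x) {a..b}"
      by (rule has_integral_eq[OF _ has_integral_cmul[OF int]])
        (simp add: linear_simps(5)[OF integrand_lin[OF abT(3)]])
    then show "I (r *\<^sub>R x) = r *\<^sub>R I x" using int has_integral_unique by blast
    have "norm (V t \<sigma> (R (U \<sigma> s x))) \<le> MV * (MU * norm x * MR)" if "\<sigma> \<in> {a..b}" for \<sigma>
    proof -
      have "norm (V t \<sigma> (R (U \<sigma> s x))) \<le> MV * norm (R (U \<sigma> s x))"
        using MV(2)[OF ts(1) abT(3)[OF that]] .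
      also have "\<dots> \<le> MV * (norm (U \<sigma> s x) * MR)" using MR MV(1) by (intro mult_left_mono) auto
      also have "\<dots> \<le> MV * (MU * norm x * MR)"
        using MV(1) MR(1) MU(2)[OF abT(3)[OF that] ts(2)]
        by (intro mult_left_mono mult_right_mono) auto
      finally show ?thesis .
    qed
    from integral_bound[OF ab(2) cont this]
    show "norm (I x) \<le> norm x * (MV * MU * MR * (b - a))"
      by (simp add: I_def ac_simps)
  qed
  have F_lin: "bounded_linear (\<lambda>x. V t b (U b s x) - V t a (U a s x))"
    by (intro bounded_linear_sub bounded_linear_compose[OF Vlin] Ulin abT ts)
  have "I x = V t b (U b s x) - V t a (U a s x)"
  proof (rule linear_eq_if_eq_on_dense[OF dense I_lin F_lin])
    fix x assume x: "x \<in> D"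
    have "((\<lambda>\<sigma>. V t \<sigma> (R (U \<sigma> s x))) has_integral V t b (U b s x) - V t a (U a s x)) {a..b}"
      by (rule fundamental_theorem_of_calculus[OF ab(2)])
        (use ab in \<open>auto intro: has_vector_derivative_within_subset[OF deriv[OF x]]\<close>)
    then show "I x = V t b (U b s x) - V t a (U a s x)"
      using int has_integral_unique by blast
  qed
  then show ?thesis using int[of x] by simp
qed

lemma generates_bidirectional_unique:
  fixes U V :: "real \<Rightarrow> real \<Rightarrow> 'a::banach \<Rightarrow> 'a"
  assumes gU: "generates_bidirectional T D B U" and gV: "generates_bidirectional T D B V"
    and dense: "closure D = UNIV" and ts: "t \<in> {0..T}" "s \<in> {0..T}"
  shows "U t s x = V t s x"
proof -
  have const: "V t b (U b s x) = V t a (U a s x)" if "0 \<le> a" "a \<le> b" "b \<le> T" for a b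
  proof -
    have "((\<lambda>\<sigma>. V t \<sigma> 0) has_integral V t b (U b s x) - V t a (U a s x)) {a..b}"
      using duhamel[OF gU gV dense bounded_linear_zero _ ts that] by simp
    moreover have "((\<lambda>\<sigma>. V t \<sigma> 0) has_integral 0) {a..b}"
      using that linear_simps(3)[OF generates_bidirectional_bounded_linear[OF gV ts(1)]]
      by (intro has_integral_is_0) auto
    ultimately have "V t b (U b s x) - V t a (U a s x) = 0" by (rule has_integral_unique)
    then show ?thesis by simp
  qed
  have "V t t (U t s x) = V t s (U s s x)"
    using const[of s t] const[of t s] ts by (cases "s \<le> t") auto
  then show ?thesis
    using generates_bidirectional_refl[OF gU ts(2)] generates_bidirectional_refl[OF gV ts(1)] by simp
qed

section \<open>Dissipation and duality for the nudged systems\<close>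

lemma inner_adjoint_comp_self:
  fixes C :: "'a::{real_inner, banach} \<Rightarrow> 'b::real_inner"
  assumes "bounded_linear C"
  shows "adjoint C (C x) \<bullet> y = C x \<bullet> C y" "x \<bullet> adjoint C (C y) = C x \<bullet> C y"
  using inner_adjoint[OF assms, of y "C x"] inner_adjoint[OF assms, of x "C y"]
  by (simp_all add: inner_commute)

lemma bounded_linear_adjoint_comp_self:
  fixes C :: "'a::{real_inner, banach} \<Rightarrow> 'b::real_inner"
  assumes "bounded_linear C"
  shows "bounded_linear (\<lambda>x. r *\<^sub>R adjoint C (C x))"
  by (intro bounded_linear_const_scaleR bounded_linear_compose[OF bounded_linear_adjoint] assms)

text \<open>
  For \<open>x\<close> in the domain this integrates the derivative \<open>2 (B t u \<bullet> u)\<close> of \<open>\<parallel>u t\<parallel>\<^sup>2\<close> along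
  \<open>u t = V t 0 x\<close>. Both sides are continuous in \<open>x\<close> because \<open>V\<close> is uniformly bounded, which gives the
  inequality for all \<open>x\<close>.
\<close>

lemma energy_dissipation:
  fixes V :: "real \<Rightarrow> real \<Rightarrow> 'a::{real_inner, banach} \<Rightarrow> 'a" and C :: "'a \<Rightarrow> 'b::real_inner"
  assumes gen: "generates_bidirectional T D B V" and dense: "closure D = UNIV"
    and C: "bounded_linear C" and T: "0 \<le> T"
    and diss: "\<And>t x. t \<in> {0..T} \<Longrightarrow> x \<in> D \<Longrightarrow> B t x \<bullet> x \<le> - (c * (norm (C x))\<^sup>2)"
  shows "(norm (V T 0 x))\<^sup>2 + 2 * c * integral {0..T} (\<lambda>t. (norm (C (V t 0 x)))\<^sup>2) \<le> (norm x)\<^sup>2"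
proof -
  have zero: "0 \<in> {0..T}" and last: "T \<in> {0..T}" using T by auto
  define I where "I x = integral {0..T} (\<lambda>t. (norm (C (V t 0 x)))\<^sup>2)" for x
  have cont: "continuous_on {0..T} (\<lambda>t. (norm (C (V t 0 x)))\<^sup>2)" for x
    by (intro continuous_intros bounded_linear.continuous_on[OF C]
        generates_bidirectional_continuous_fst[OF gen zero])
  have int: "((\<lambda>t. (norm (C (V t 0 x)))\<^sup>2) has_integral I x) {0..T}" for x
    unfolding I_def using integrable_continuous_real[OF cont] by (rule integrable_integral)
  have on_domain: "(norm (V T 0 x))\<^sup>2 + 2 * c * I x \<le> (norm x)\<^sup>2" if x: "x \<in> D" for x
  proof -
    define u where "u t = V t 0 x" for t
    have "((\<lambda>t. u t \<bullet> u t) has_vector_derivative u t \<bullet> B t (u t) + B t (u t) \<bullet> u t)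
        (at t within {0..T})" if "t \<in> {0..T}" for t
      unfolding u_def
      by (intro bounded_bilinear.has_vector_derivative[OF bounded_bilinear_inner]
          generates_bidirectional_deriv_fst[OF gen that zero x])
    then have "((\<lambda>t. u t \<bullet> B t (u t) + B t (u t) \<bullet> u t) has_integral u T \<bullet> u T - u 0 \<bullet> u 0) {0..T}"
      by (rule fundamental_theorem_of_calculus[OF T])
    moreover have "((\<lambda>t. - (2 * c) * (norm (C (u t)))\<^sup>2) has_integral - (2 * c) * I x) {0..T}"
      unfolding u_def by (rule has_integral_mult_right[OF int])
    moreover have "u t \<bullet> B t (u t) + B t (u t) \<bullet> u t \<le> - (2 * c) * (norm (C (u t)))\<^sup>2"
      if "t \<in> {0..T}" for t
      using diss[OF that, of "u t"] generates_bidirectional_domain[OF gen that zero x]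
      by (simp add: u_def inner_commute)
    ultimately have "u T \<bullet> u T - u 0 \<bullet> u 0 \<le> - (2 * c) * I x" by (rule has_integral_le)
    then show ?thesis
      by (simp add: u_def generates_bidirectional_refl[OF gen zero] power2_norm_eq_inner)
  qed
  obtain MV where MV: "MV \<ge> 0" "\<And>t s x. t \<in> {0..T} \<Longrightarrow> s \<in> {0..T} \<Longrightarrow> norm (V t s x) \<le> MV * norm x"
    using generates_bidirectional_uniformly_bounded[OF gen] by blast
  obtain MC where MC: "MC \<ge> 0" "\<And>x. norm (C x) \<le> norm x * MC"
    using bounded_linear.nonneg_bounded[OF C] by blast
  define N where "N = MV * MC"
  have N0: "0 \<le> N" unfolding N_def using MV MC by simp
  have N: "norm (C (V t 0 y)) \<le> N * norm y" if "t \<in> {0..T}" for t y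
  proof -
    have "norm (C (V t 0 y)) \<le> norm (V t 0 y) * MC" by (rule MC)
    also have "\<dots> \<le> MV * norm y * MC" using MC(1) MV(2)[OF that zero] by (rule mult_right_mono[rotated])
    finally show ?thesis by (simp add: N_def ac_simps)
  qed
  have I_dist: "norm (I y - I x) \<le> (N * norm (y - x)) * (N * norm y + N * norm x) * T" for x y
  proof -
    have "norm ((norm (C (V t 0 y)))\<^sup>2 - (norm (C (V t 0 x)))\<^sup>2)
        \<le> (N * norm (y - x)) * (N * norm y + N * norm x)" if t: "t \<in> {0..T}" for t
    proof -
      let ?a = "C (V t 0 y)" and ?b = "C (V t 0 x)"
      have "bounded_linear (\<lambda>x. C (V t 0 x))"
        by (intro bounded_linear_compose[OF C] generates_bidirectional_bounded_linear[OF gen t zero])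
      then have "?a - ?b = C (V t 0 (y - x))" by (rule linear_simps(2)[symmetric])
      then have "\<bar>norm ?a - norm ?b\<bar> \<le> N * norm (y - x)"
        using norm_triangle_ineq3[of ?a ?b] N[OF t, of "y - x"] by simp
      moreover have "\<bar>norm ?a + norm ?b\<bar> \<le> N * norm y + N * norm x"
        using N[OF t, of x] N[OF t, of y] by simp
      ultimately have "\<bar>norm ?a - norm ?b\<bar> * \<bar>norm ?a + norm ?b\<bar>
          \<le> (N * norm (y - x)) * (N * norm y + N * norm x)"
        using N0 by (intro mult_mono) auto
      moreover have "(norm ?a)\<^sup>2 - (norm ?b)\<^sup>2 = (norm ?a - norm ?b) * (norm ?a + norm ?b)"
        by (simp add: power2_eq_square algebra_simps)
      ultimately show ?thesis by (simp add: abs_mult)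
    qed
    from integral_bound[OF T continuous_on_diff[OF cont cont] this]
    show ?thesis
      using integral_unique[OF has_integral_diff[OF int int]] by simp
  qed
  obtain xs where xs: "\<And>k. xs k \<in> D" "xs \<longlonglongrightarrow> x"
    using dense closure_sequential[of x D] by auto
  have "(\<lambda>k. (N * norm (xs k - x)) * (N * norm (xs k) + N * norm x) * T)
      \<longlonglongrightarrow> (N * norm (x - x)) * (N * norm x + N * norm x) * T"
    by (intro tendsto_intros xs)
  then have "(\<lambda>k. I (xs k) - I x) \<longlonglongrightarrow> 0"
    by (intro Lim_null_comparison[OF always_eventually[OF allI[OF I_dist]]]) simp
  then have I: "(\<lambda>k. I (xs k)) \<longlonglongrightarrow> I x" by (simp add: LIM_zero_iff)
  have "(\<lambda>k. (norm (V T 0 (xs k)))\<^sup>2 + 2 * c * I (xs k)) \<longlonglongrightarrow> (norm (V T 0 x))\<^sup>2 + 2 * c * I x"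
    by (intro tendsto_intros xs I
        bounded_linear.tendsto[OF generates_bidirectional_bounded_linear[OF gen last zero]])
  moreover have "(\<lambda>k. (norm (xs k))\<^sup>2) \<longlonglongrightarrow> (norm x)\<^sup>2" by (intro tendsto_intros xs)
  ultimately have "(norm (V T 0 x))\<^sup>2 + 2 * c * I x \<le> (norm x)\<^sup>2"
    by (rule LIMSEQ_le) (use on_domain xs in blast)
  then show ?thesis by (simp add: I_def)
qed

lemma nudged_energy_dissipation:
  fixes S :: "real \<Rightarrow> real \<Rightarrow> 'a::{real_inner, banach} \<Rightarrow> 'a" and C :: "'a \<Rightarrow> 'b::real_inner"
  assumes gS: "generates_bidirectional T D (nudged A C r) S" and dense: "closure D = UNIV"
    and C: "bounded_linear C" and T: "0 \<le> T" and det: "weakly_detectable \<mu> T D A C"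
  shows "(norm (S T 0 x))\<^sup>2 + 2 * (r - \<mu>) * integral {0..T} (\<lambda>t. (norm (C (S t 0 x)))\<^sup>2) \<le> (norm x)\<^sup>2"
proof (rule energy_dissipation[OF gS dense C T])
  fix t x assume "t \<in> {0..T}" "x \<in> D"
  then have "A t x \<bullet> x \<le> \<mu> * (norm (C x))\<^sup>2" using det by (simp add: weakly_detectable_def)
  then show "nudged A C r t x \<bullet> x \<le> - ((r - \<mu>) * (norm (C x))\<^sup>2)"
    by (simp add: nudged_def inner_diff_left inner_adjoint_comp_self[OF C] algebra_simps
        power2_norm_eq_inner)
qed

text \<open>
  If the nudged system conserves the norm of \<open>x\<close>, the dissipation inequality forces its output to
  vanish. The correction term is then inactive, so by Duhamel's formula the free trajectory from \<open>x\<close>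
  is the same, and its output vanishes as well.
\<close>

lemma norm_conserved_imp_unobservable:
  fixes U S :: "real \<Rightarrow> real \<Rightarrow> 'a::{real_inner, banach} \<Rightarrow> 'a" and C :: "'a \<Rightarrow> 'b::real_inner"
  assumes gU: "generates_bidirectional T D A U"
    and gS: "generates_bidirectional T D (nudged A C r) S" and dense: "closure D = UNIV"
    and C: "bounded_linear C" and T: "0 < T" and det: "weakly_detectable \<mu> T D A C" and r: "\<mu> < r"
    and conserved: "norm (S T 0 x) = norm x"
  shows "observability_gramian T U C x = 0"
proof -
  have zero: "0 \<in> {0..T}" using T by auto
  let ?g = "\<lambda>t. (norm (C (S t 0 x)))\<^sup>2"
  have cont: "continuous_on {0..T} ?g"
    by (intro continuous_intros bounded_linear.continuous_on[OF C]
        generates_bidirectional_continuous_fst[OF gS zero])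
  have "2 * (r - \<mu>) * integral {0..T} ?g \<le> 0"
    using nudged_energy_dissipation[OF gS dense C less_imp_le[OF T] det, of x] conserved by simp
  then have "integral {0..T} ?g \<le> 0" using r by (simp add: mult_le_0_iff)
  moreover have "integral {0..T} ?g \<ge> 0"
    by (intro integral_nonneg integrable_continuous_real cont) simp
  ultimately have "integral {0..T} ?g = 0" by simp
  then have CS: "C (S t 0 x) = 0" if "t \<in> {0..T}" for t
    using integral_eq_0_iff[OF cont T] that by simp
  have adj0: "adjoint C 0 = 0" using linear_simps(3)[OF bounded_linear_adjoint[OF C]] .
  have CU: "C (U t 0 x) = 0" if t: "t \<in> {0..T}" for t
  proof -
    have R: "bounded_linear (\<lambda>x. - (r *\<^sub>R adjoint C (C x)))"
      by (intro bounded_linear_minus bounded_linear_adjoint_comp_self C)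
    have "((\<lambda>\<sigma>. U t \<sigma> (- (r *\<^sub>R adjoint C (C (S \<sigma> 0 x))))) has_integral
        U t t (S t 0 x) - U t 0 (S 0 0 x)) {0..t}"
      by (rule duhamel[OF gS gU dense R]) (use t in \<open>auto simp: nudged_def\<close>)
    moreover have "((\<lambda>\<sigma>. U t \<sigma> (- (r *\<^sub>R adjoint C (C (S \<sigma> 0 x))))) has_integral 0) {0..t}"
      using t by (intro has_integral_is_0)
        (auto simp: CS adj0 linear_simps[OF generates_bidirectional_bounded_linear[OF gU t]])
    ultimately have "U t t (S t 0 x) - U t 0 (S 0 0 x) = 0" by (rule has_integral_unique)
    then have "U t 0 x = S t 0 x"
      by (simp add: generates_bidirectional_refl[OF gU t] generates_bidirectional_refl[OF gS zero])
    then show ?thesis using CS[OF t] by simp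
  qed
  have "observability_gramian T U C x = integral {0..T} (\<lambda>t. 0)"
    unfolding observability_gramian_def
    by (rule integral_cong) (simp add: CU adj0 linear_simps(3)[OF bounded_linear_adjoint]
        generates_bidirectional_bounded_linear[OF gU _ zero])
  then show ?thesis by simp
qed

lemma skew_adjoint_inner:
  assumes skew: "skew_adjoint D A" and dense: "closure D = UNIV" and x: "x \<in> D" and y: "y \<in> D"
  shows "A x \<bullet> y = - (x \<bullet> A y)"
proof -
  have "y \<in> unbounded_adjoint_dom D A" using skew y by (simp add: skew_adjoint_def)
  then obtain w where w: "\<forall>x\<in>D. A x \<bullet> y = x \<bullet> w" by (auto simp: unbounded_adjoint_dom_def)
  have "unbounded_adjoint D A y = w"
    unfolding unbounded_adjoint_def
  proof (rule the_equality)
    show "\<forall>x\<in>D. A x \<bullet> y = x \<bullet> w" by (rule w)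
    fix w' assume w': "\<forall>x\<in>D. A x \<bullet> y = x \<bullet> w'"
    have "z \<bullet> w' = z \<bullet> w" for z
      by (rule linear_eq_if_eq_on_dense[OF dense bounded_linear_inner_left bounded_linear_inner_left])
        (use w w' in force)
    then show "w' = w" by (metis inner_commute vector_eq_rdot)
  qed
  moreover have "unbounded_adjoint D A y = - A y" using skew y by (simp add: skew_adjoint_def)
  ultimately have "w = - A y" by simp
  then show ?thesis using w x by simp
qed

text \<open>
  For \<open>x\<close> and \<open>y\<close> in the domain, \<open>t \<mapsto> S t 0 x \<bullet> S' t T y\<close> is constant: skew-symmetry cancels the
  contributions of \<open>A\<close>, and the gains \<open>r\<close> and \<open>-r\<close> cancel those of \<open>C\<^sup>* C\<close>. Its values at \<open>T\<close> and \<open>0\<close>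
  are the two sides of the adjoint relation.
\<close>

lemma backward_nudged_eq_adjoint_of_forward:
  fixes S S' :: "real \<Rightarrow> real \<Rightarrow> 'a::{real_inner, banach} \<Rightarrow> 'a" and C :: "'a \<Rightarrow> 'b::real_inner"
  assumes gS: "generates_bidirectional T D (nudged A C r) S"
    and gS': "generates_bidirectional T D (nudged A C (- r)) S'"
    and dense: "closure D = UNIV" and C: "bounded_linear C" and T: "0 \<le> T"
    and skew: "\<And>t x y. t \<in> {0..T} \<Longrightarrow> x \<in> D \<Longrightarrow> y \<in> D \<Longrightarrow> A t x \<bullet> y = - (x \<bullet> A t y)"
  shows "S' 0 T = adjoint (S T 0)"
proof -
  have zero: "0 \<in> {0..T}" and last: "T \<in> {0..T}" using T by auto
  have on_domain: "S T 0 x \<bullet> y = x \<bullet> S' 0 T y" if x: "x \<in> D" and y: "y \<in> D" for x y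
  proof -
    have "((\<lambda>t. S t 0 x \<bullet> S' t T y) has_vector_derivative 0) (at t within {0..T})"
      if t: "t \<in> {0..T}" for t
    proof -
      let ?u = "S t 0 x" and ?v = "S' t T y"
      have D: "?u \<in> D" "?v \<in> D"
        using generates_bidirectional_domain[OF gS t zero x]
          generates_bidirectional_domain[OF gS' t last y] by auto
      have "((\<lambda>t. S t 0 x \<bullet> S' t T y) has_vector_derivative
          ?u \<bullet> nudged A C (- r) t ?v + nudged A C r t ?u \<bullet> ?v) (at t within {0..T})"
        by (intro bounded_bilinear.has_vector_derivative[OF bounded_bilinear_inner]
            generates_bidirectional_deriv_fst[OF gS t zero x]
            generates_bidirectional_deriv_fst[OF gS' t last y])
      moreover have "?u \<bullet> nudged A C (- r) t ?v + nudged A C r t ?u \<bullet> ?v = 0"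
        using skew[OF t D]
        by (simp add: nudged_def inner_diff_left inner_diff_right inner_add_right
            inner_adjoint_comp_self[OF C])
      ultimately show ?thesis by simp
    qed
    from fundamental_theorem_of_calculus[OF T this]
    have "((\<lambda>t. 0::real) has_integral S T 0 x \<bullet> S' T T y - S 0 0 x \<bullet> S' 0 T y) {0..T}" .
    from has_integral_unique[OF this has_integral_0] show ?thesis
      by (simp add: generates_bidirectional_refl[OF gS zero] generates_bidirectional_refl[OF gS' last])
  qed
  note S = generates_bidirectional_bounded_linear[OF gS last zero]
  note S' = generates_bidirectional_bounded_linear[OF gS' zero last]
  have 1: "S T 0 x \<bullet> y = x \<bullet> S' 0 T y" if y: "y \<in> D" for x y
    by (rule linear_eq_if_eq_on_dense[OF dense _ bounded_linear_inner_left])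
      (use on_domain y in \<open>auto intro: bounded_linear_compose[OF bounded_linear_inner_left S]\<close>)
  have "S T 0 x \<bullet> y = x \<bullet> S' 0 T y" for x y
    by (rule linear_eq_if_eq_on_dense[OF dense bounded_linear_inner_right])
      (use 1 in \<open>auto intro: bounded_linear_compose[OF bounded_linear_inner_right S']\<close>)
  then show ?thesis using adjoint_unique[of "S T 0" "S' 0 T"] by simp
qed

section \<open>The back and forth iteration\<close>

text \<open>
  The free trajectory solves the nudged equation with its own output as data. Duhamel's formula with
  perturbation \<open>r C\<^sup>* C\<close> expresses this, so the data cancel in the difference.
\<close>

lemma nudging_error:
  fixes S :: "real \<Rightarrow> real \<Rightarrow> 'a::{real_inner, banach} \<Rightarrow> 'a" and C :: "'a \<Rightarrow> 'b::real_inner"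
  assumes gS: "generates_bidirectional T D (nudged A C r) S" and dense: "closure D = UNIV"
    and C: "bounded_linear C"
    and z: "system_solution T D A z0 z" and w: "nudging_solution T D A C r (\<lambda>t. C (z t)) t0 v w"
    and ts: "t \<in> {0..T}" "t0 \<in> {0..T}"
  shows "w t - z t = S t t0 (v - z t0)"
proof -
  have zero: "0 \<in> {0..T}" using ts by auto
  obtain U where gU: "generates_bidirectional T D A U"
    and zU: "\<And>t. t \<in> {0..T} \<Longrightarrow> z t = U t 0 z0 + integral {0..t} (\<lambda>s. U t s 0)"
    using z unfolding system_solution_def mild_solution_def by force
  have z_eq: "z t = U t 0 z0" if t: "t \<in> {0..T}" for t
  proof -
    have "integral {0..t} (\<lambda>s. U t s 0) = integral {0..t} (\<lambda>s. 0)"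
      by (rule integral_cong)
        (use t in \<open>auto simp: linear_simps(3)[OF generates_bidirectional_bounded_linear[OF gU t]]\<close>)
    then show ?thesis using zU[OF t] by simp
  qed
  have z_flow: "U s t0 (z t0) = z s" if "s \<in> {0..T}" for s
    using that ts by (simp add: z_eq generates_bidirectional_comp[OF gU _ _ zero])
  \<comment> \<open>A mild solution comes with an evolution system of its own; uniqueness identifies it with \<open>S\<close>.\<close>
  obtain V where gV: "generates_bidirectional T D (nudged A C r) V"
    and wV: "w t = V t t0 v +
             (if t0 \<le> t then integral {t0..t} (\<lambda>s. V t s (r *\<^sub>R adjoint C (C (z s))))
              else - integral {t..t0} (\<lambda>s. V t s (r *\<^sub>R adjoint C (C (z s)))))"
    using w ts(1) unfolding nudging_solution_def mild_solution_def by blast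
  have VS: "V t s x = S t s x" if "s \<in> {0..T}" for s x
    using generates_bidirectional_unique[OF gV gS dense ts(1) that] .
  have duh: "integral {a..b} (\<lambda>s. V t s (r *\<^sub>R adjoint C (C (z s)))) = S t b (z b) - S t a (z a)"
    if ab: "0 \<le> a" "a \<le> b" "b \<le> T" for a b
  proof (rule integral_unique)
    have "((\<lambda>s. S t s (r *\<^sub>R adjoint C (C (U s t0 (z t0))))) has_integral
        S t b (U b t0 (z t0)) - S t a (U a t0 (z t0))) {a..b}"
      by (rule duhamel[OF gU gS dense bounded_linear_adjoint_comp_self[OF C] _ ts ab])
        (simp add: nudged_def)
    then have "((\<lambda>s. S t s (r *\<^sub>R adjoint C (C (U s t0 (z t0))))) has_integral
        S t b (z b) - S t a (z a)) {a..b}" using ab by (simp add: z_flow)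
    then show "((\<lambda>s. V t s (r *\<^sub>R adjoint C (C (z s)))) has_integral
        S t b (z b) - S t a (z a)) {a..b}"
      by (rule has_integral_eq[rotated]) (use ab in \<open>simp add: z_flow VS\<close>)
  qed
  have "w t = S t t0 v + (S t t (z t) - S t t0 (z t0))"
    using duh[of t0 t] duh[of t t0] ts wV VS[OF ts(2)] by (cases "t0 \<le> t") auto
  then show ?thesis
    by (simp add: generates_bidirectional_refl[OF gS ts(1)]
        linear_simps[OF generates_bidirectional_bounded_linear[OF gS ts]])
qed

lemma back_and_forth_error:
  fixes Sp Sm :: "real \<Rightarrow> real \<Rightarrow> 'a::{real_inner, banach} \<Rightarrow> 'a" and C :: "'a \<Rightarrow> 'b::real_inner"
  assumes gSp: "generates_bidirectional T D (nudged A C r) Sp"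
    and gSm: "generates_bidirectional T D (nudged A C (- r)) Sm"
    and dense: "closure D = UNIV" and C: "bounded_linear C" and T: "0 \<le> T"
    and z: "system_solution T D A z0 z"
    and zhat: "back_and_forth_nudging T D A C r (\<lambda>t. C (z t)) zhat0 zhat"
  shows "zhat (2 * n) 0 - z 0 = ((Sm 0 T \<circ> Sp T 0) ^^ n) (zhat0 - z 0)"
proof (induction n)
  have zero: "0 \<in> {0..T}" and last: "T \<in> {0..T}" using T by auto
  note fwd = nudging_error[OF gSp dense C z] and bwd = nudging_error[OF gSm dense C z]
  have first: "nudging_solution T D A C r (\<lambda>t. C (z t)) 0 zhat0 (zhat 0)"
    and forward: "\<And>n. nudging_solution T D A C r (\<lambda>t. C (z t)) 0 (zhat (2 * n + 1) 0) (zhat (2 * n + 2))"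
    and backward: "\<And>n. nudging_solution T D A C (- r) (\<lambda>t. C (z t)) T (zhat (2 * n) T) (zhat (2 * n + 1))"
  proof -
    fix n
    show "nudging_solution T D A C r (\<lambda>t. C (z t)) 0 zhat0 (zhat 0)"
      and "nudging_solution T D A C (- r) (\<lambda>t. C (z t)) T (zhat (2 * n) T) (zhat (2 * n + 1))"
      using zhat unfolding back_and_forth_nudging_def by blast+
    have "nudging_solution T D A C r (\<lambda>t. C (z t)) 0 (zhat (2 * Suc n - 1) 0) (zhat (2 * Suc n))"
      using zhat unfolding back_and_forth_nudging_def by (metis le_add1 plus_1_eq_Suc)
    then show "nudging_solution T D A C r (\<lambda>t. C (z t)) 0 (zhat (2 * n + 1) 0) (zhat (2 * n + 2))"
      by simp
  qed
  show "zhat (2 * 0) 0 - z 0 = ((Sm 0 T \<circ> Sp T 0) ^^ 0) (zhat0 - z 0)"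
    using fwd[OF first zero zero] by (simp add: generates_bidirectional_refl[OF gSp zero])
  fix n assume IH: "zhat (2 * n) 0 - z 0 = ((Sm 0 T \<circ> Sp T 0) ^^ n) (zhat0 - z 0)"
  \<comment> \<open>The forward pass starts from the initial guess or from the preceding backward pass. In
    both cases the error relation at time \<open>0\<close> identifies its starting point \<open>v\<close> with \<open>zhat (2 * n) 0\<close>.\<close>
  have "\<exists>v. nudging_solution T D A C r (\<lambda>t. C (z t)) 0 v (zhat (2 * n))"
    using first forward[of "n - 1"] by (cases n) auto
  then obtain v where v: "nudging_solution T D A C r (\<lambda>t. C (z t)) 0 v (zhat (2 * n))" by blast
  have "zhat (2 * n) 0 - z 0 = v - z 0"
    using fwd[OF v zero zero] by (simp add: generates_bidirectional_refl[OF gSp zero])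
  then have "zhat (2 * n) T - z T = Sp T 0 (zhat (2 * n) 0 - z 0)"
    using fwd[OF v last zero] by simp
  moreover have "zhat (2 * n + 1) 0 - z 0 = Sm 0 T (zhat (2 * n) T - z T)"
    using bwd[OF backward zero last] .
  moreover have "zhat (2 * n + 2) 0 - z 0 = zhat (2 * n + 1) 0 - z 0"
    using fwd[OF forward zero zero] by (simp add: generates_bidirectional_refl[OF gSp zero])
  ultimately show "zhat (2 * Suc n) 0 - z 0 = ((Sm 0 T \<circ> Sp T 0) ^^ Suc n) (zhat0 - z 0)"
    using IH by simp
qed

text \<open>
  The limit \<open>y\<close> is fixed by \<open>L = S\<^sup>* S\<close> with \<open>S = Sp T 0\<close>, so \<open>\<parallel>S y\<parallel>\<^sup>2 = L y \<bullet> y = \<parallel>y\<parallel>\<^sup>2\<close> and no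
  energy is dissipated along the trajectory of \<open>y\<close>.
\<close>

lemma back_and_forth_iterates_converge:
  fixes U Sp Sm :: "real \<Rightarrow> real \<Rightarrow> 'a::{real_inner, banach} \<Rightarrow> 'a" and C :: "'a \<Rightarrow> 'b::real_inner"
  assumes gU: "generates_bidirectional T D A U"
    and gSp: "generates_bidirectional T D (nudged A C r) Sp"
    and gSm: "generates_bidirectional T D (nudged A C (- r)) Sm"
    and dense: "closure D = UNIV" and C: "bounded_linear C" and T: "0 < T"
    and det: "weakly_detectable \<mu> T D A C" and r: "\<mu> < r"
    and adj: "Sm 0 T = adjoint (Sp T 0)"
  shows "\<exists>y. (\<lambda>n. ((Sm 0 T \<circ> Sp T 0) ^^ n) x) \<longlonglongrightarrow> y \<and> observability_gramian T U C y = 0"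
proof -
  have zero: "0 \<in> {0..T}" and last: "T \<in> {0..T}" using T by auto
  note Sp = generates_bidirectional_bounded_linear[OF gSp last zero]
  note Sm = generates_bidirectional_bounded_linear[OF gSm zero last]
  have dual: "Sp T 0 u \<bullet> v = u \<bullet> Sm 0 T v" for u v
    unfolding adj by (rule inner_adjoint[OF Sp, symmetric])
  have contr: "norm (Sp T 0 u) \<le> norm u" for u
  proof (rule power2_le_imp_le)
    have "0 \<le> integral {0..T} (\<lambda>t. (norm (C (Sp t 0 u)))\<^sup>2)"
      by (intro integral_nonneg integrable_continuous_real continuous_intros
          bounded_linear.continuous_on[OF C] generates_bidirectional_continuous_fst[OF gSp zero]) simp
    then have "0 \<le> 2 * (r - \<mu>) * integral {0..T} (\<lambda>t. (norm (C (Sp t 0 u)))\<^sup>2)"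
      using r by simp
    then show "(norm (Sp T 0 u))\<^sup>2 \<le> (norm u)\<^sup>2"
      using nudged_energy_dissipation[OF gSp dense C less_imp_le[OF T] det, of u] by linarith
  qed simp
  obtain y where y: "(\<lambda>n. ((Sm 0 T \<circ> Sp T 0) ^^ n) x) \<longlonglongrightarrow> y" "Sm 0 T (Sp T 0 y) = y"
    using powers_of_adjoint_comp_contraction_converge[OF dual contr Sp Sm] by blast
  have "(norm (Sp T 0 y))\<^sup>2 = (norm y)\<^sup>2"
    using dual[of y "Sp T 0 y"] y(2) by (simp add: power2_norm_eq_inner)
  then have "norm (Sp T 0 y) = norm y" by simp
  from norm_conserved_imp_unobservable[OF gU gSp dense C T det r this] y(1) show ?thesis by blast
qed

lemma observer_if_iterates_converge:
  fixes Sp Sm :: "real \<Rightarrow> real \<Rightarrow> 'a::{real_inner, banach} \<Rightarrow> 'a" and C :: "'a \<Rightarrow> 'b::real_inner"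
  assumes gSp: "generates_bidirectional T D (nudged A C r) Sp"
    and gSm: "generates_bidirectional T D (nudged A C (- r)) Sm"
    and dense: "closure D = UNIV" and C: "bounded_linear C" and T: "0 \<le> T"
    and lim: "\<And>e. (\<lambda>n. orth_proj E (((Sm 0 T \<circ> Sp T 0) ^^ n) e)) \<longlonglongrightarrow> 0"
  shows "strong_back_and_forth_observer T D A C r E"
  unfolding strong_back_and_forth_observer_def
  using back_and_forth_error[OF gSp gSm dense C T] lim by auto

lemma nudged_eq:
  "(\<lambda>t x. A t x - r *\<^sub>R adjoint C (C x)) = nudged A C r"
  "(\<lambda>t x. A t x + r *\<^sub>R adjoint C (C x)) = nudged A C (- r)"
  by (auto simp: fun_eq_iff nudged_def)

lemma system_solution_initial:
  assumes "system_solution T D A z0 z" "0 \<le> T"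
  shows "z 0 = z0"
proof -
  obtain U where "generates_bidirectional T D A U" "z 0 = U 0 0 z0"
    using assms unfolding system_solution_def mild_solution_def by force
  then show ?thesis using generates_bidirectional_refl assms(2) by fastforce
qed

theorem theorem3p9:
  fixes T :: real
    and D :: "'a::{real_inner, banach} set"
    and A :: "real \<Rightarrow> 'a \<Rightarrow> 'a"
    and C :: "'a \<Rightarrow> 'b::{real_inner, banach}"
    and U :: "real \<Rightarrow> real \<Rightarrow> 'a \<Rightarrow> 'a"
  assumes "0 < T"
    and "bounded_linear C"
    and "standing_assumptions T D A"
    and "generates_bidirectional T D A U"
  shows
    "(\<forall>\<mu> r Sp Sm.
        0 \<le> \<mu> \<and>
        weakly_detectable \<mu> T D A C \<and>
        weakly_detectable \<mu> T D (\<lambda>t x. - A t x) C \<and>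
        \<mu> < r \<and>
        generates_bidirectional T D (\<lambda>t x. A t x - r *\<^sub>R adjoint C (C x)) Sp \<and>
        generates_bidirectional T D (\<lambda>t x. A t x + r *\<^sub>R adjoint C (C x)) Sm \<and>
        Sm 0 T = adjoint (Sp T 0) \<and>
        observable_subspace T U C = UNIV \<longrightarrow>
          strong_back_and_forth_observer T D A C r UNIV \<and>
          (\<forall>z0 zhat0 z zhat n.
             system_solution T D A z0 z \<and>
             back_and_forth_nudging T D A C r (\<lambda>t. C (z t)) zhat0 zhat \<longrightarrow>
             zhat (2 * n) 0 - z 0 = ((Sm 0 T \<circ> Sp T 0) ^^ n) (zhat0 - z0)) \<and>
          (\<forall>\<epsilon>0. (\<lambda>n. ((Sm 0 T \<circ> Sp T 0) ^^ n) \<epsilon>0) \<longlonglongrightarrow> 0))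
     \<and>
     ((\<exists>A0. (\<forall>t\<in>{0..T}. \<forall>x\<in>D. A t x = A0 x) \<and> skew_adjoint D A0) \<longrightarrow>
      (\<forall>r Sp Sm.
        0 < r \<and>
        generates_bidirectional T D (\<lambda>t x. A t x - r *\<^sub>R adjoint C (C x)) Sp \<and>
        generates_bidirectional T D (\<lambda>t x. A t x + r *\<^sub>R adjoint C (C x)) Sm \<longrightarrow>
          strong_back_and_forth_observer T D A C r (observable_subspace T U C) \<and>
          (\<forall>z0 zhat0 z zhat n.
             system_solution T D A z0 z \<and>
             back_and_forth_nudging T D A C r (\<lambda>t. C (z t)) zhat0 zhat \<longrightarrow>
             zhat (2 * n) 0 - z 0 = ((Sm 0 T \<circ> Sp T 0) ^^ n) (zhat0 - z0)) \<and>
          (\<forall>\<epsilon>0. (\<lambda>n. orth_proj (observable_subspace T U C)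
                       (((Sm 0 T \<circ> Sp T 0) ^^ n) \<epsilon>0)) \<longlonglongrightarrow> 0)))"
proof -
  note T = assms(1) and C = assms(2) and gU = assms(4)
  have T0: "0 \<le> T" using T by simp
  have dense: "closure D = UNIV" using assms(3) by (simp add: standing_assumptions_def)
  have error: "zhat (2 * n) 0 - z 0 = ((Sm 0 T \<circ> Sp T 0) ^^ n) (zhat0 - z0)"
    if "generates_bidirectional T D (nudged A C r) Sp"
      "generates_bidirectional T D (nudged A C (- r)) Sm"
      "system_solution T D A z0 z" "back_and_forth_nudging T D A C r (\<lambda>t. C (z t)) zhat0 zhat"
    for r Sp Sm z0 z zhat0 zhat n
    using back_and_forth_error[OF that(1,2) dense C T0 that(3,4), of n]
      system_solution_initial[OF that(3) T0] by simp
  have part1: "(\<lambda>n. ((Sm 0 T \<circ> Sp T 0) ^^ n) e) \<longlonglongrightarrow> 0"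
    if h: "generates_bidirectional T D (nudged A C r) Sp"
      "generates_bidirectional T D (nudged A C (- r)) Sm"
      "weakly_detectable \<mu> T D A C" "\<mu> < r" "Sm 0 T = adjoint (Sp T 0)"
      and obs: "observable_subspace T U C = UNIV" for \<mu> r Sp Sm e
  proof -
    obtain y where y: "(\<lambda>n. ((Sm 0 T \<circ> Sp T 0) ^^ n) e) \<longlonglongrightarrow> y" "observability_gramian T U C y = 0"
      using back_and_forth_iterates_converge[OF gU h(1,2) dense C T h(3-5)] by blast
    have "y \<in> observable_subspace T U C" using obs by simp
    then have "y \<bullet> y = 0"
      using y(2) by (simp add: observable_subspace_def orthogonal_comp_def orthogonal_def)
    then show ?thesis using y(1) by simp
  qed
  have part2: "(\<lambda>n. orth_proj (observable_subspace T U C) (((Sm 0 T \<circ> Sp T 0) ^^ n) e)) \<longlonglongrightarrow> 0"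
    if gens: "generates_bidirectional T D (nudged A C r) Sp"
      "generates_bidirectional T D (nudged A C (- r)) Sm"
      and r: "0 < r" and A0: "\<forall>t\<in>{0..T}. \<forall>x\<in>D. A t x = A0 x" "skew_adjoint D A0"
    for r Sp Sm e A0
  proof -
    have skew: "A t x \<bullet> y = - (x \<bullet> A t y)" if "t \<in> {0..T}" "x \<in> D" "y \<in> D" for t x y
      using skew_adjoint_inner[OF A0(2) dense that(2,3)] A0(1) that by simp
    have "A t x \<bullet> x = 0" if "t \<in> {0..T}" "x \<in> D" for t x
      using skew[OF that that(2)] by (simp add: inner_commute)
    then have det: "weakly_detectable 0 T D A C" by (simp add: weakly_detectable_def)
    have adj: "Sm 0 T = adjoint (Sp T 0)"
      using backward_nudged_eq_adjoint_of_forward[OF gens dense C T0 skew] .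
    obtain y where y: "(\<lambda>n. ((Sm 0 T \<circ> Sp T 0) ^^ n) e) \<longlonglongrightarrow> y" "observability_gramian T U C y = 0"
      using back_and_forth_iterates_converge[OF gU gens dense C T det r adj] by blast
    have le: "norm (orth_proj (observable_subspace T U C) u) \<le> norm (u - y)" for u
      unfolding observable_subspace_def
      by (rule norm_orth_proj_orthogonal_comp_le) (use y(2) in simp)
    show ?thesis
      by (rule Lim_null_comparison[OF always_eventually[OF allI[OF le]]])
        (use y(1) in \<open>intro tendsto_norm_zero LIM_zero\<close>)
  qed
  show ?thesis
    unfolding nudged_eq
  proof (intro conjI allI impI; (elim conjE exE)?)
    fix \<mu> r Sp Sm
    assume h: "generates_bidirectional T D (nudged A C r) Sp"
      "generates_bidirectional T D (nudged A C (- r)) Sm"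
      "weakly_detectable \<mu> T D A C" "\<mu> < r" "Sm 0 T = adjoint (Sp T 0)"
      "observable_subspace T U C = UNIV"
    show "(\<lambda>n. ((Sm 0 T \<circ> Sp T 0) ^^ n) e) \<longlonglongrightarrow> 0" for e
      using part1[OF h] .
    then show "strong_back_and_forth_observer T D A C r UNIV"
      by (intro observer_if_iterates_converge[OF h(1,2) dense C T0]) (simp add: orth_proj_UNIV)
  next
    fix r Sp Sm A0
    assume h: "generates_bidirectional T D (nudged A C r) Sp"
      "generates_bidirectional T D (nudged A C (- r)) Sm"
      "0 < r" "\<forall>t\<in>{0..T}. \<forall>x\<in>D. A t x = A0 x" "skew_adjoint D A0"
    show "(\<lambda>n. orth_proj (observable_subspace T U C) (((Sm 0 T \<circ> Sp T 0) ^^ n) e)) \<longlonglongrightarrow> 0" for e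
      using part2[OF h] .
    then show "strong_back_and_forth_observer T D A C r (observable_subspace T U C)"
      by (rule observer_if_iterates_converge[OF h(1,2) dense C T0])
  qed (rule error; assumption)+
qed

end
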